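(* Let $K$ be an $(i+1)$-path connected finite simplicial complex and let $\Sigma$ be an $i$-motif of $K$. Then the complex $K^{\Sigma}$ obtained from $K$ by duplication of $\Sigma$ is $(i+1)$-path connected, and $\lambda_{\max}(\Delta_i^{up}(K^{\Sigma}))=i+2$ if and only if $B_i(K)$ is balanced.
   Context: For a set $S$ of simplices of $K$: the closure $\mathrm{Cl}\,S$ is the smallest subcomplex containing $S$; the star $\mathrm{St}\,S$ is the set of simplices of $K$ having a face in $S$; the link is $\mathrm{Lk}\,S=\mathrm{Cl}\,\mathrm{St}\,S-\mathrm{St}\,\mathrm{Cl}\,S$. A subcomplex $\Sigma$ of $K$ is an $i$-motif if (1) whenever $F_1,F_2\in\Sigma$ and $F_1,F_2\subset F\in K$ then $F\in\Sigma$, and (2) $\dim\mathrm{Lk}\,\Sigma=i$. Duplication: let $V(\Sigma)=\{v_0,\dots,v_k\}$, $V(\mathrm{Lk}\,\Sigma)=\{u_0,\dots,u_m\}$, and let $\Sigma'$ be a copy of $\Sigma$ on new vertices $v'_0,\dots,v'_k$ via $v_j\mapsto v'_j$. Then $K^{\Sigma}=K\cup\{\{v'_{i_0},\dots,v'_{i_l},u_{j_1},\dots,u_{j_s}\}:\{v_{i_0},\dots,v_{i_l},u_{j_1},\dots,u_{j_s}\}\in K\}$. A simplicial complex is a finite set family closed under subsets; an $i$-face has $i+1$ vertices; $S_i(K)$ is the set of $i$-faces; facets are maximal faces. With an orientation (vertex orderings up to even permutations), for oriented $[\bar F]=[v_0,\dots,v_{i+1}]$ and $F=\bar F\setminus\{v_j\}$,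 $\operatorname{sgn}([F],\partial[\bar F])=\pm(-1)^j$ with $+$ iff the orientation of $F$ agrees with $[v_0,\dots,\hat v_j,\dots,v_{i+1}]$. Normalized weights: $w(F)=1$ for facets and $w(F)=\sum_{\bar F\in S_{i+1}(K),F\subset\bar F}w(\bar F)$ for non-facet $i$-faces. The $i$-th up normalized Laplacian $\Delta_i^{up}(K)$ acts on $f:S_i(K)\to\mathbb R$ by $(\Delta_i^{up}f)(F)=\sum_{\bar F\supset F}\frac{w(\bar F)}{w(F)}f(F)+\sum_{F'\ne F,\ F\cup F'=\bar F\in S_{i+1}(K)}\frac{w(\bar F)}{w(F)}\operatorname{sgn}([F],\partial[\bar F])\operatorname{sgn}([F'],\partial[\bar F])f(F')$; its spectrum is orientation independent and lies in $[0,i+2]$; $\lambda_{\max}$ is its largest eigenvalue. An $(i+1)$-path is a sequence of $(i+1)$-faces $\bar F_1,\dots,\bar F_m$ with $\bar F_j\cap\bar F_l$ an $i$-face iff $|j-l|=1$; $K$ is $(i+1)$-path connected if any two $(i+1)$-faces are joined by one. $B_i(K)$ is the bipartite signed graph on $S_i(K)\cup S_{i+1}(K)$ with edges $\{F,\bar F\}$ for $F\subset\bar F$, signed by $\operatorname{sgn}([F],\partial[\bar F])$; it is balanced if every cycle has positive sign product (independent of orientation). *)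

theory Defs
  imports Complex_Main "HOL-Combinatorics.Permutations"
begin

section \<open>Simplicial complexes, stars and links\<close>

definition simplicial_complex :: "'a set set \<Rightarrow> bool" where
  "simplicial_complex K \<longleftrightarrow> finite K \<and> (\<forall>F\<in>K. \<forall>G. G \<subseteq> F \<longrightarrow> G \<in> K)"

definition subcomplex :: "'a set set \<Rightarrow> 'a set set \<Rightarrow> bool" where
  "subcomplex L K \<longleftrightarrow> simplicial_complex L \<and> L \<subseteq> K"

definition vertex_set :: "'a set set \<Rightarrow> 'a set" where
  "vertex_set K = \<Union>K"

definition faces :: "'a set set \<Rightarrow> nat \<Rightarrow> 'a set set" where
  "faces K i = {F \<in> K. card F = i + 1}"

definition is_facet :: "'a set set \<Rightarrow> 'a set \<Rightarrow> bool" where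
  "is_facet K F \<longleftrightarrow> F \<in> K \<and> \<not> (\<exists>G\<in>K. F \<subset> G)"

text \<open>The dimension of a finite family; both the void family and the family consisting of
  the empty face only have dimension -1.\<close>

definition cplx_dim :: "'a set set \<Rightarrow> int" where
  "cplx_dim L = (if L = {} then -1 else Max ((\<lambda>F. int (card F) - 1) ` L))"

definition cplx_closure :: "'a set set \<Rightarrow> 'a set set \<Rightarrow> 'a set set" where
  "cplx_closure K S = \<Inter>{L. subcomplex L K \<and> S \<subseteq> L}"

text \<open>A complex contains the empty set, but the face in \<open>S\<close> required of a simplex of the
  star is a genuine (nonempty) one; with the empty face admitted the star of every nonempty
  subcomplex would be all of \<open>K\<close> and every link would be void.\<close>

definition cplx_star :: "'a set set \<Rightarrow> 'a set set \<Rightarrow> 'a set set" where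
  "cplx_star K S = {F \<in> K. \<exists>G\<in>S. G \<noteq> {} \<and> G \<subseteq> F}"

definition cplx_link :: "'a set set \<Rightarrow> 'a set set \<Rightarrow> 'a set set" where
  "cplx_link K S = cplx_closure K (cplx_star K S) - cplx_star K (cplx_closure K S)"

section \<open>Motifs and duplication\<close>

text \<open>The first condition says that a simplex of \<open>K\<close> spanned by two simplices of \<open>\<Sigma>\<close>
  belongs to \<open>\<Sigma>\<close>, i.e. \<open>\<Sigma>\<close> is a full subcomplex. If it were imposed on all \<open>F \<in> K\<close>
  with \<open>F\<^sub>1, F\<^sub>2 \<subseteq> F\<close>, the case where \<open>F\<^sub>1 = F\<^sub>2\<close> is a vertex would put
  every simplex of the star of \<open>\<Sigma>\<close> into \<open>\<Sigma>\<close>, and no link could have dimension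
  \<open>i \<ge> 0\<close>. Requiring it only for distinct nonempty \<open>F\<^sub>1, F\<^sub>2\<close> would give a
  special case of the present notion.\<close>

definition motif :: "'a set set \<Rightarrow> nat \<Rightarrow> 'a set set \<Rightarrow> bool" where
  "motif K i \<Sigma> \<longleftrightarrow>
     subcomplex \<Sigma> K \<and>
     (\<forall>F\<^sub>1\<in>\<Sigma>. \<forall>F\<^sub>2\<in>\<Sigma>. F\<^sub>1 \<union> F\<^sub>2 \<in> K \<longrightarrow> F\<^sub>1 \<union> F\<^sub>2 \<in> \<Sigma>) \<and>
     cplx_dim (cplx_link K \<Sigma>) = int i"

text \<open>The vertices of the copy are named by a map \<open>c\<close> sending \<open>v\<^sub>j\<close> to its duplicate.\<close>

definition copy_map :: "'a set set \<Rightarrow> 'a set set \<Rightarrow> ('a \<Rightarrow> 'a) \<Rightarrow> bool" where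
  "copy_map K \<Sigma> c \<longleftrightarrow> inj_on c (vertex_set \<Sigma>) \<and> c ` vertex_set \<Sigma> \<inter> vertex_set K = {}"

definition duplication :: "'a set set \<Rightarrow> 'a set set \<Rightarrow> ('a \<Rightarrow> 'a) \<Rightarrow> 'a set set" where
  "duplication K \<Sigma> c =
     K \<union> {c ` A \<union> B | A B.
            A \<noteq> {} \<and> A \<subseteq> vertex_set \<Sigma> \<and> B \<subseteq> vertex_set (cplx_link K \<Sigma>) \<and> A \<union> B \<in> K}"

section \<open>Path connectedness\<close>

text \<open>The argument \<open>i\<close> below stands for \<open>(i+1)\<close>-paths, which run through
  \<open>(i+1)\<close>-faces.\<close>

definition up_path :: "'a set set \<Rightarrow> nat \<Rightarrow> 'a set list \<Rightarrow> bool" where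
  "up_path K i Fs \<longleftrightarrow>
     Fs \<noteq> [] \<and> set Fs \<subseteq> faces K (i + 1) \<and>
     (\<forall>j<length Fs. \<forall>l<length Fs.
        Fs ! j \<inter> Fs ! l \<in> faces K i \<longleftrightarrow> \<bar>int j - int l\<bar> = 1)"

definition up_path_connected :: "'a set set \<Rightarrow> nat \<Rightarrow> bool" where
  "up_path_connected K i \<longleftrightarrow>
     (\<forall>F\<in>faces K (i + 1). \<forall>G\<in>faces K (i + 1).
        \<exists>Fs. up_path K i Fs \<and> hd Fs = F \<and> last Fs = G)"

section \<open>Orientations and incidence signs\<close>

text \<open>An orientation is given by a representative vertex ordering of every face. Orderings
  are only ever compared up to even permutations.\<close>

definition orientation :: "'a set set \<Rightarrow> ('a set \<Rightarrow> 'a list) \<Rightarrow> bool" where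
  "orientation K \<omega> \<longleftrightarrow> (\<forall>F\<in>K. distinct (\<omega> F) \<and> set (\<omega> F) = F)"

definition same_orientation :: "'a list \<Rightarrow> 'a list \<Rightarrow> bool" where
  "same_orientation xs ys \<longleftrightarrow> (\<exists>p. p permutes set xs \<and> evenperm p \<and> ys = map p xs)"

definition omit_nth :: "nat \<Rightarrow> 'a list \<Rightarrow> 'a list" where
  "omit_nth j xs = take j xs @ drop (Suc j) xs"

text \<open>The sign of \<open>[F]\<close> in the boundary of \<open>[G]\<close>, meaningful when \<open>F\<close> arises from
  \<open>G\<close> by removing one vertex.\<close>

definition incidence_sgn :: "('a set \<Rightarrow> 'a list) \<Rightarrow> 'a set \<Rightarrow> 'a set \<Rightarrow> real" where
  "incidence_sgn \<omega> F G =
     (let j = (THE j. j < length (\<omega> G) \<and> F = G - {\<omega> G ! j})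
      in (if same_orientation (\<omega> F) (omit_nth j (\<omega> G)) then 1 else -1) * (-1) ^ j)"

section \<open>The normalized up Laplacian\<close>

function face_weight :: "'a set set \<Rightarrow> 'a set \<Rightarrow> real" where
  "face_weight K F =
     (if infinite K \<or> F \<notin> K then 0
      else if is_facet K F then 1
      else (\<Sum>G\<in>{G \<in> K. F \<subset> G \<and> card G = card F + 1}. face_weight K G))"
  by pat_completeness auto
termination
proof (relation "measure (\<lambda>(K, F). card {H \<in> K. F \<subset> H})", goal_cases)
  case 1
  show ?case by simp
next
  case (2 K F G)
  then have "finite K" "G \<in> K" "F \<subset> G" by auto
  then have "{H \<in> K. G \<subset> H} \<subset> {H \<in> K. F \<subset> H}" by blast
  with \<open>finite K\<close> show ?case by (simp add: psubset_card_mono)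
qed

declare face_weight.simps [simp del]

definition up_laplacian ::
  "'a set set \<Rightarrow> ('a set \<Rightarrow> 'a list) \<Rightarrow> nat \<Rightarrow> ('a set \<Rightarrow> real) \<Rightarrow> 'a set \<Rightarrow> real" where
  "up_laplacian K \<omega> i f F =
     (\<Sum>G\<in>{G \<in> faces K (i + 1). F \<subset> G}. face_weight K G / face_weight K F * f F) +
     (\<Sum>F'\<in>{F' \<in> faces K i. F' \<noteq> F \<and> F \<union> F' \<in> faces K (i + 1)}.
        face_weight K (F \<union> F') / face_weight K F *
        incidence_sgn \<omega> F (F \<union> F') * incidence_sgn \<omega> F' (F \<union> F') * f F')"

text \<open>Functions on the \<open>i\<close>-faces are represented by total functions whose values elsewhere
  are irrelevant.\<close>

definition up_eigenvalue :: "'a set set \<Rightarrow> ('a set \<Rightarrow> 'a list) \<Rightarrow> nat \<Rightarrow> real \<Rightarrow> bool" where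
  "up_eigenvalue K \<omega> i \<mu> \<longleftrightarrow>
     (\<exists>f. (\<exists>F\<in>faces K i. f F \<noteq> 0) \<and> (\<forall>F\<in>faces K i. up_laplacian K \<omega> i f F = \<mu> * f F))"

definition lambda_max :: "'a set set \<Rightarrow> ('a set \<Rightarrow> 'a list) \<Rightarrow> nat \<Rightarrow> real" where
  "lambda_max K \<omega> i = Max {\<mu>. up_eigenvalue K \<omega> i \<mu>}"

section \<open>The signed incidence graph and balance\<close>

text \<open>Edges are two-element sets of vertices; a cycle is given by the list of its pairwise
  distinct vertices in cyclic order.\<close>

definition cycle_edge :: "'v list \<Rightarrow> nat \<Rightarrow> 'v set" where
  "cycle_edge vs k = {vs ! k, vs ! (Suc k mod length vs)}"

definition is_cycle :: "'v set set \<Rightarrow> 'v list \<Rightarrow> bool" where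
  "is_cycle E vs \<longleftrightarrow>
     3 \<le> length vs \<and> distinct vs \<and> (\<forall>k<length vs. cycle_edge vs k \<in> E)"

definition balanced_signed_graph :: "'v set set \<Rightarrow> ('v set \<Rightarrow> real) \<Rightarrow> bool" where
  "balanced_signed_graph E \<sigma> \<longleftrightarrow>
     (\<forall>vs. is_cycle E vs \<longrightarrow> (\<Prod>k<length vs. \<sigma> (cycle_edge vs k)) > 0)"

definition incidence_edges :: "'a set set \<Rightarrow> nat \<Rightarrow> 'a set set set" where
  "incidence_edges K i = {{F, G} | F G. F \<in> faces K i \<and> G \<in> faces K (i + 1) \<and> F \<subset> G}"

text \<open>For an edge \<open>e = {F, G}\<close> with \<open>F \<subset> G\<close> the two ends are \<open>F = \<Inter>e\<close> and \<open>G = \<Union>e\<close>.\<close>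

definition edge_sgn :: "('a set \<Rightarrow> 'a list) \<Rightarrow> 'a set set \<Rightarrow> real" where
  "edge_sgn \<omega> e = incidence_sgn \<omega> (\<Inter>e) (\<Union>e)"

text \<open>Balance of \<open>B\<^sub>i(K)\<close>; its vertices play no role beyond the edges, since a cycle only
  meets vertices on edges.\<close>

definition incidence_graph_balanced :: "'a set set \<Rightarrow> ('a set \<Rightarrow> 'a list) \<Rightarrow> nat \<Rightarrow> bool" where
  "incidence_graph_balanced K \<omega> i \<longleftrightarrow>
     balanced_signed_graph (incidence_edges K i) (edge_sgn \<omega>)"

end

theory Submission
  imports Defs "Jordan_Normal_Form.Char_Poly"
begin

text \<open>Two facts are combined. First, a row of the up Laplacian is an average, over the cofaces
  of a face, of signed sums of \<open>i + 2\<close> values. By the maximum principle no eigenvalue exceeds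
  \<open>i + 2\<close>, and for an eigenfunction with eigenvalue \<open>i + 2\<close> the property of having maximal
  modulus spreads along \<open>(i+1)\<close>-paths; its signs then form a potential
  \<open>\<epsilon>\<close> with \<open>sgn([F], \<partial>[G]) = \<epsilon> F * \<epsilon> G\<close>, and conversely. Such a potential exists iff the
  incidence graph is balanced. Second, the simplicial map of the duplication onto \<open>K\<close> that
  identifies every new vertex with its original is injective on faces and restricts to the identity
  on \<open>K\<close>, so potentials restrict to \<open>K\<close> and pull back from it. Paths of \<open>K\<close> through the star of
  \<open>\<Sigma>\<close> lift to the copy, which shares the \<open>i\<close>-faces of the link with \<open>K\<close>.\<close>

section \<open>Incidence signs in terms of inversions\<close>

text \<open>For injective \<open>\<rho>\<close>, the sign of the permutation that sorts the list by
  \<open>\<rho>\<close>: each inverted pair contributes -1. Comparing all vertex orderings with one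
  fixed order replaces permutations by explicit products.\<close>

fun inv_sgn :: "('a \<Rightarrow> nat) \<Rightarrow> 'a list \<Rightarrow> real" where
  "inv_sgn \<rho> [] = 1"
| "inv_sgn \<rho> (x # xs) = (\<Prod>y\<leftarrow>xs. if \<rho> x < \<rho> y then 1 else -1) * inv_sgn \<rho> xs"

lemma prod_list_pm1:
  fixes f :: "'a \<Rightarrow> real"
  assumes "\<And>x. f x \<in> {1, -1}"
  shows "(\<Prod>x\<leftarrow>xs. f x) \<in> {1, -1}"
proof (induction xs)
  case (Cons x xs)
  with assms[of x] show ?case by auto
qed simp

lemma inv_sgn_pm1: "inv_sgn \<rho> xs \<in> {1, -1}"
proof (induction xs)
  case (Cons x xs)
  have "(\<Prod>y\<leftarrow>xs. if \<rho> x < \<rho> y then 1 else -1 :: real) \<in> {1, -1}"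
    by (rule prod_list_pm1) auto
  with Cons show ?case by auto
qed simp

lemma inv_sgn_adjacent_swap:
  assumes "\<rho> a \<noteq> \<rho> b"
  shows "inv_sgn \<rho> (us @ a # b # ws) = - inv_sgn \<rho> (us @ b # a # ws)"
  using assms by (induction us) auto

text \<open>By adjacent swaps: \<open>a\<close> moves past \<open>c\<close>, is exchanged with
  \<open>b\<close> over the shorter gap, and \<open>b\<close> moves past \<open>c\<close>; three
  sign changes in all. \<open>us\<close> is generalised because it absorbs \<open>c\<close>.\<close>

lemma inv_sgn_swap:
  assumes "inj_on \<rho> (set (us @ a # vs @ b # ws))" "distinct (us @ a # vs @ b # ws)"
  shows "inv_sgn \<rho> (us @ a # vs @ b # ws) = - inv_sgn \<rho> (us @ b # vs @ a # ws)"
  using assms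
proof (induction vs arbitrary: us)
  case Nil
  then have "\<rho> a \<noteq> \<rho> b" by (auto simp: inj_on_def)
  then show ?case using inv_sgn_adjacent_swap by simp
next
  case (Cons c vs)
  have "\<rho> a \<noteq> \<rho> c" "\<rho> c \<noteq> \<rho> b" using Cons.prems by (auto simp: inj_on_def)
  then have "inv_sgn \<rho> (us @ a # (c # vs) @ b # ws) = - inv_sgn \<rho> ((us @ [c]) @ a # vs @ b # ws)"
    "inv_sgn \<rho> ((us @ [c]) @ b # vs @ a # ws) = - inv_sgn \<rho> (us @ b # (c # vs) @ a # ws)"
    using inv_sgn_adjacent_swap[of \<rho> a c us "vs @ b # ws"]
      inv_sgn_adjacent_swap[of \<rho> c b us "vs @ a # ws"] by simp_all
  moreover have "inv_sgn \<rho> ((us @ [c]) @ a # vs @ b # ws) = - inv_sgn \<rho> ((us @ [c]) @ b # vs @ a # ws)"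
    using Cons.prems by (intro Cons.IH) (auto simp: inj_on_def)
  ultimately show ?case by simp
qed

lemma inv_sgn_map_transpose:
  assumes "inj_on \<rho> (set xs)" "distinct xs" "a \<in> set xs" "b \<in> set xs" "a \<noteq> b"
  shows "inv_sgn \<rho> (map (transpose a b) xs) = - inv_sgn \<rho> xs"
proof -
  have *: "inv_sgn \<rho> (map (transpose a b) xs) = - inv_sgn \<rho> xs"
    if xs: "xs = us @ a # vs @ b # ws" for us a vs b ws
  proof -
    have id: "map (transpose a b) zs = zs" if "a \<notin> set zs" "b \<notin> set zs" for zs
      using that by (intro map_idI) (auto simp: transpose_def)
    have "map (transpose a b) xs = us @ b # vs @ a # ws"
      using assms(2) by (simp add: xs id)
    with assms(1,2) show ?thesis by (simp add: inv_sgn_swap xs)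
  qed
  obtain us zs where us: "xs = us @ a # zs" using assms(3) by (auto dest: split_list)
  with assms(4,5) have "b \<in> set us \<or> b \<in> set zs" by auto
  then show ?thesis
  proof
    assume "b \<in> set zs"
    then obtain vs ws where "zs = vs @ b # ws" by (auto dest: split_list)
    with us show ?thesis by (intro *) simp
  next
    assume "b \<in> set us"
    then obtain vs ws where "us = vs @ b # ws" by (auto dest: split_list)
    with us have "inv_sgn \<rho> (map (transpose b a) xs) = - inv_sgn \<rho> xs"
      by (intro *[of vs b ws a zs]) simp
    then show ?thesis by (simp add: transpose_commute)
  qed
qed

text \<open>A permutation is a product of transpositions, and each of these flips both
  signs.\<close>

lemma inv_sgn_map_permutation:
  assumes "p permutes set xs" "inj_on \<rho> (set xs)" "distinct xs"
  shows "inv_sgn \<rho> (map p xs) = sign p * inv_sgn \<rho> xs"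
proof -
  have "finite (set xs)" by simp
  with assms(1) show ?thesis
  proof (induction rule: permutes_induct)
    case id
    then show ?case by simp
  next
    case (swap a b p)
    have img: "set (map p xs) = set xs" using swap.hyps by (simp add: permutes_image)
    have "permutation p" using swap.hyps permutation_permutes by auto
    have "inv_sgn \<rho> (map (transpose a b) (map p xs)) = - inv_sgn \<rho> (map p xs)"
    proof (rule inv_sgn_map_transpose)
      show "distinct (map p xs)"
        using assms(3) swap.hyps permutes_inj_on by (auto simp: distinct_map)
    qed (use img assms(2) swap.hyps in auto)
    moreover have "sign (transpose a b \<circ> p) = - sign p"
      using swap.hyps \<open>permutation p\<close> by (simp only: sign_compose permutation_swap_id sign_swap_id) simp
    ultimately show ?case using swap.IH by (simp add: o_def)
  qed
qed

lemma distinct_lists_permutation: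
  assumes "distinct xs" "distinct ys" "set xs = set ys"
  obtains p where "p permutes set xs" "map p xs = ys"
proof -
  have len: "length xs = length ys" using assms distinct_card by metis
  define p where "p x = (case map_of (zip xs ys) x of Some y \<Rightarrow> y | None \<Rightarrow> x)" for x
  have nth: "p (xs ! k) = ys ! k" if "k < length xs" for k
    using that assms(1) len by (simp add: p_def map_of_zip_nth)
  have map: "map p xs = ys" using len nth by (intro nth_equalityI) auto
  have "bij_betw p (set xs) (set xs)"
    unfolding bij_betw_def
  proof
    show "p ` set xs = set xs" using map assms(3) by (metis set_map)
    then show "inj_on p (set xs)" by (simp add: finite_surj_inj)
  qed
  moreover have "p x = x" if "x \<notin> set xs" for x
  proof -
    have "map_of (zip xs ys) x = None" using that len by (simp add: map_of_zip_is_None)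
    then show ?thesis by (simp add: p_def)
  qed
  ultimately have "p permutes set xs" by (rule bij_imp_permutes)
  with map that show thesis by blast
qed

text \<open>Two orderings of one set differ by a permutation \<open>p\<close>, which multiplies
  \<open>inv_sgn\<close> by \<open>sign p\<close>; as \<open>inv_sgn\<close> is nonzero, equality
  means that \<open>p\<close> is even.\<close>

lemma same_orientation_iff_inv_sgn:
  assumes "distinct xs" "distinct ys" "set xs = set ys" "inj_on \<rho> (set xs)"
  shows "same_orientation xs ys \<longleftrightarrow> inv_sgn \<rho> xs = inv_sgn \<rho> ys"
proof -
  have nz: "inv_sgn \<rho> xs \<noteq> 0" using inv_sgn_pm1[of \<rho> xs] by auto
  show ?thesis
  proof
    assume "same_orientation xs ys"
    then obtain p where "p permutes set xs" "evenperm p" "ys = map p xs"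
      by (auto simp: same_orientation_def)
    with assms show "inv_sgn \<rho> xs = inv_sgn \<rho> ys" by (simp add: inv_sgn_map_permutation sign_def)
  next
    assume eq: "inv_sgn \<rho> xs = inv_sgn \<rho> ys"
    obtain p where p: "p permutes set xs" "map p xs = ys"
      using distinct_lists_permutation[OF assms(1-3)] by blast
    with assms eq nz have "sign p = (1 :: int)"
      using inv_sgn_map_permutation[of p xs \<rho>] by (auto simp: sign_def split: if_splits)
    then have "evenperm p" by (simp add: sign_def split: if_splits)
    with p show "same_orientation xs ys" by (auto simp: same_orientation_def)
  qed
qed

section \<open>Incidence signs relative to a fixed vertex order\<close>

text \<open>A pair of \<open>v\<close> with a later \<open>u\<close> contributes exactly the factor
  on the right, a pair with an earlier \<open>u\<close> its negative. The resulting power of -1 is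
  the positional sign of the boundary operator.\<close>

lemma inv_sgn_remove:
  assumes "\<rho> v \<notin> \<rho> ` set ws"
  shows "inv_sgn \<rho> (us @ v # ws) =
    inv_sgn \<rho> (us @ ws) * (-1) ^ length us * (\<Prod>u\<leftarrow>us @ ws. if \<rho> u < \<rho> v then -1 else 1)"
proof (induction us)
  case Nil
  have "(\<Prod>y\<leftarrow>ws. if \<rho> v < \<rho> y then 1 else - 1 :: real) = (\<Prod>u\<leftarrow>ws. if \<rho> u < \<rho> v then - 1 else 1)"
  proof (intro arg_cong[of _ _ prod_list] map_cong refl)
    fix x assume "x \<in> set ws"
    with assms have "\<rho> v \<noteq> \<rho> x" by auto
    then show "(if \<rho> v < \<rho> x then 1 else - 1 :: real) = (if \<rho> x < \<rho> v then - 1 else 1)" by auto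
  qed
  then show ?case by simp
next
  case (Cons x us)
  then show ?case by simp
qed

text \<open>The sign of the incidence when all faces are oriented by increasing values of \<open>\<rho>\<close>.\<close>

definition order_sgn :: "('a \<Rightarrow> nat) \<Rightarrow> 'a set \<Rightarrow> 'a set \<Rightarrow> real" where
  "order_sgn \<rho> F G = (\<Prod>u\<in>F. \<Prod>v\<in>G - F. if \<rho> u < \<rho> v then -1 else 1)"

text \<open>Whichever index \<open>THE\<close> returns, both factors are signs, so values can be
  cancelled without checking incidence.\<close>

lemma incidence_sgn_pm1: "incidence_sgn \<omega> F G \<in> {1, -1}"
  by (auto simp: incidence_sgn_def Let_def minus_one_power_iff)

text \<open>The positional power of -1 cancels against the one in \<open>inv_sgn_remove\<close>.
  What remains depends on the sets alone, up to one sign per face: a change of orientation is a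
  switching of the signed graph.\<close>

lemma incidence_sgn_conv_order_sgn:
  assumes "orientation K \<omega>" "F \<in> K" "insert v F \<in> K" "v \<notin> F" "inj_on \<rho> (insert v F)"
  shows "incidence_sgn \<omega> F (insert v F) =
    inv_sgn \<rho> (\<omega> F) * inv_sgn \<rho> (\<omega> (insert v F)) * order_sgn \<rho> F (insert v F)"
proof -
  let ?G = "insert v F"
  have F: "distinct (\<omega> F)" "set (\<omega> F) = F" and G: "distinct (\<omega> ?G)" "set (\<omega> ?G) = ?G"
    using assms by (auto simp: orientation_def)
  have "v \<in> set (\<omega> ?G)" using G by simp
  then obtain us ws where us: "\<omega> ?G = us @ v # ws" by (auto dest: split_list)
  have F_eq: "set (us @ ws) = F" and dist: "distinct (us @ ws)"
    using G us assms(4) by auto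
  have j: "(THE j. j < length (\<omega> ?G) \<and> F = ?G - {\<omega> ?G ! j}) = length us"
  proof (rule the_equality)
    show "length us < length (\<omega> ?G) \<and> F = ?G - {\<omega> ?G ! length us}"
      using us assms(4) by auto
    fix j assume j: "j < length (\<omega> ?G) \<and> F = ?G - {\<omega> ?G ! j}"
    then have "\<omega> ?G ! j \<in> ?G" "\<omega> ?G ! j \<notin> F" using G nth_mem by blast+
    then have "\<omega> ?G ! j = \<omega> ?G ! length us" using us by auto
    with j G us show "j = length us" by (subst (asm) nth_eq_iff_index_eq) auto
  qed
  have om: "omit_nth (length us) (\<omega> ?G) = us @ ws" by (simp add: omit_nth_def us)
  have "inj_on \<rho> F" using assms(5) by (rule inj_on_subset) auto
  then have so: "same_orientation (\<omega> F) (us @ ws) \<longleftrightarrow> inv_sgn \<rho> (\<omega> F) = inv_sgn \<rho> (us @ ws)"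
    by (intro same_orientation_iff_inv_sgn) (use F F_eq dist in simp_all)
  have "\<rho> v \<notin> \<rho> ` F" using assms(4,5) by (auto simp: inj_on_def)
  then have "\<rho> v \<notin> \<rho> ` set ws" using F_eq by auto
  then have "inv_sgn \<rho> (\<omega> ?G) =
      inv_sgn \<rho> (us @ ws) * (-1) ^ length us * (\<Prod>u\<leftarrow>us @ ws. if \<rho> u < \<rho> v then -1 else 1)"
    unfolding us by (rule inv_sgn_remove)
  moreover have "(\<Prod>u\<leftarrow>us @ ws. if \<rho> u < \<rho> v then -1 else 1) = order_sgn \<rho> F ?G"
  proof -
    have "?G - F = {v}" using assms(4) by auto
    then have "order_sgn \<rho> F ?G = (\<Prod>u\<in>F. if \<rho> u < \<rho> v then -1 else 1)"
      by (simp add: order_sgn_def)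
    also have "\<dots> = (\<Prod>u\<leftarrow>us @ ws. if \<rho> u < \<rho> v then -1 else 1)"
      unfolding F_eq[symmetric] by (rule prod.distinct_set_conv_list[OF dist])
    finally show ?thesis by simp
  qed
  moreover have "order_sgn \<rho> F ?G \<in> {1, -1}"
    unfolding calculation(2)[symmetric] by (rule prod_list_pm1) auto
  ultimately show ?thesis
    using inv_sgn_pm1[of \<rho> "us @ ws"] inv_sgn_pm1[of \<rho> "\<omega> F"]
    by (auto simp: incidence_sgn_def j om so minus_one_power_iff)
qed

section \<open>Paths and potentials of signed graphs\<close>

lemma rtrancl_imp_walk:
  assumes "(x, y) \<in> R\<^sup>*"
  shows "\<exists>xs. xs \<noteq> [] \<and> hd xs = x \<and> last xs = y \<and> (\<forall>j. Suc j < length xs \<longrightarrow> (xs ! j, xs ! Suc j) \<in> R)"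
  using assms
proof (induction rule: converse_rtrancl_induct)
  case base
  show ?case by (intro exI[of _ "[y]"]) simp
next
  case (step x z)
  then obtain xs where "xs \<noteq> []" "hd xs = z" "last xs = y"
    "\<forall>j. Suc j < length xs \<longrightarrow> (xs ! j, xs ! Suc j) \<in> R" by blast
  with step.hyps show ?case
    by (intro exI[of _ "x # xs"]) (auto simp: nth_Cons hd_conv_nth split: nat.splits)
qed

text \<open>A walk of minimal length has neither chords nor repetitions. Chordlessness is what an
  \<open>(i+1)\<close>-path demands; distinctness is what closing the path to a cycle
  demands.\<close>

lemma rtrancl_imp_induced_path:
  assumes "(x, y) \<in> R\<^sup>*" "sym R" "irrefl R"
  obtains xs where "xs \<noteq> []" "hd xs = x" "last xs = y" "distinct xs"
    "\<And>j l. j < length xs \<Longrightarrow> l < length xs \<Longrightarrow> (xs ! j, xs ! l) \<in> R \<longleftrightarrow> \<bar>int j - int l\<bar> = 1"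
proof -
  define walk where "walk xs \<longleftrightarrow> xs \<noteq> [] \<and> hd xs = x \<and> last xs = y \<and>
    (\<forall>j. Suc j < length xs \<longrightarrow> (xs ! j, xs ! Suc j) \<in> R)" for xs
  have "\<exists>xs. walk xs" using rtrancl_imp_walk[OF assms(1)] by (simp add: walk_def)
  then obtain xs where xs: "walk xs" and min: "\<And>ys. walk ys \<Longrightarrow> length xs \<le> length ys"
    by (metis ex_has_least_nat)
  \<comment> \<open>A chord from position \<open>j\<close> to \<open>l\<close> allows cutting out
    everything strictly between them.\<close>
  have short: "walk (take (Suc j) xs @ drop l xs)" if "j < l" "l < length xs" "(xs ! j, xs ! l) \<in> R" for j l
  proof -
    let ?ys = "take (Suc j) xs @ drop l xs"
    have "(?ys ! m, ?ys ! Suc m) \<in> R" if m: "Suc m < length ?ys" for m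
    proof -
      consider "m < j" | "m = j" | "m > j" by linarith
      then show ?thesis
      proof cases
        case 1
        with xs \<open>j < l\<close> \<open>l < length xs\<close> show ?thesis by (auto simp: walk_def nth_append)
      next
        case 2
        with \<open>j < l\<close> \<open>l < length xs\<close> \<open>(xs ! j, xs ! l) \<in> R\<close> show ?thesis by (auto simp: nth_append)
      next
        case 3
        with m \<open>j < l\<close> \<open>l < length xs\<close> have "Suc (l + (m - Suc j)) < length xs" by auto
        with xs have "(xs ! (l + (m - Suc j)), xs ! Suc (l + (m - Suc j))) \<in> R" by (simp add: walk_def)
        with 3 m \<open>j < l\<close> \<open>l < length xs\<close> show ?thesis
          by (auto simp: nth_append min_def Suc_diff_Suc)
      qed
    qed
    with xs that show ?thesis by (auto simp: walk_def hd_append)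
  qed
  have adj: "l = Suc j" if "j < l" "l < length xs" "(xs ! j, xs ! l) \<in> R" for j l
    using min[OF short[OF that]] that by auto
  \<comment> \<open>Of two equal entries, the second either has a successor, which gives a chord
    from the first, or is last, so that the walk may stop at the first.\<close>
  have rep: "xs ! j \<noteq> xs ! l" if "j < l" "l < length xs" for j l
  proof
    assume eq: "xs ! j = xs ! l"
    show False
    proof (cases "Suc l < length xs")
      case True
      with xs have "(xs ! l, xs ! Suc l) \<in> R" by (simp add: walk_def)
      with adj[of j "Suc l"] True that eq show False by simp
    next
      case False
      with that have l: "l = length xs - 1" by simp
      have "walk (take (Suc j) xs)"
        using xs that eq l by (auto simp: walk_def last_conv_nth hd_conv_nth min_def)
      from min[OF this] that show False by simp
    qed
  qed
  have "distinct xs"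
    unfolding distinct_conv_nth using rep by (metis linorder_neqE_nat)
  moreover have "(xs ! j, xs ! l) \<in> R \<longleftrightarrow> \<bar>int j - int l\<bar> = 1" if "j < length xs" "l < length xs" for j l
  proof
    assume R: "(xs ! j, xs ! l) \<in> R"
    then have R': "(xs ! l, xs ! j) \<in> R" using assms(2) by (auto dest: symD)
    have "j \<noteq> l" using R assms(3) by (auto simp: irrefl_def)
    then show "\<bar>int j - int l\<bar> = 1"
      using adj[OF _ _ R] adj[OF _ _ R'] that by (cases "j < l") auto
  next
    assume "\<bar>int j - int l\<bar> = 1"
    then have "l = Suc j \<or> j = Suc l" by auto
    with xs that assms(2) show "(xs ! j, xs ! l) \<in> R" by (auto simp: walk_def dest: symD)
  qed
  ultimately show thesis using that xs by (auto simp: walk_def)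
qed

section \<open>Balance and switching of signed graphs\<close>

text \<open>A switching function that makes all edges positive. It is a sign at every vertex, also
  off the graph, so that its values can always be cancelled.\<close>

definition is_potential :: "'v set set \<Rightarrow> ('v set \<Rightarrow> real) \<Rightarrow> ('v \<Rightarrow> real) \<Rightarrow> bool" where
  "is_potential E \<sigma> \<epsilon> \<longleftrightarrow> (\<forall>v. \<epsilon> v \<in> {1, -1}) \<and> (\<forall>u v. {u, v} \<in> E \<longrightarrow> \<sigma> {u, v} = \<epsilon> u * \<epsilon> v)"

lemma prod_rotate:
  fixes g :: "nat \<Rightarrow> 'b :: comm_monoid_mult"
  shows "(\<Prod>k<n. g (Suc k mod n)) = (\<Prod>k<n. g k)"
proof (cases n)
  case (Suc m)
  have "(\<Prod>k<Suc m. g (Suc k mod Suc m)) = (\<Prod>k<m. g (Suc k)) * g 0" by simp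
  also have "\<dots> = (\<Prod>k<Suc m. g k)" by (subst prod.lessThan_Suc_shift) (simp add: mult.commute)
  finally show ?thesis by (simp add: Suc)
qed simp

text \<open>Every vertex of a cycle lies on two of its edges, so the sign product is a
  square.\<close>

lemma potential_imp_balanced:
  assumes "is_potential E \<sigma> \<epsilon>"
  shows "balanced_signed_graph E \<sigma>"
  unfolding balanced_signed_graph_def
proof (intro allI impI)
  fix vs assume "is_cycle E vs"
  then have "(\<Prod>k<length vs. \<sigma> (cycle_edge vs k)) =
      (\<Prod>k<length vs. \<epsilon> (vs ! k) * \<epsilon> (vs ! (Suc k mod length vs)))"
    using assms by (intro prod.cong) (auto simp: is_cycle_def is_potential_def cycle_edge_def)
  also have "\<dots> = (\<Prod>k<length vs. \<epsilon> (vs ! k)) ^ 2"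
    by (simp add: prod.distrib prod_rotate[of "\<lambda>k. \<epsilon> (vs ! k)"] power2_eq_square)
  also have "\<dots> > 0"
  proof -
    have "\<epsilon> v \<noteq> 0" for v using assms by (auto simp: is_potential_def) (metis zero_neq_neg_one zero_neq_one)
    then show ?thesis by simp
  qed
  finally show "(\<Prod>k<length vs. \<sigma> (cycle_edge vs k)) > 0" .
qed

text \<open>Induction on the edges. A new edge inside a component closes a cycle with an induced
  path, and positivity of that cycle is the required equation; a new edge between two components is
  corrected by flipping one of them if necessary.\<close>

lemma balanced_imp_potential:
  assumes "finite E" "\<And>e. e \<in> E \<Longrightarrow> card e = 2" "\<And>e. \<sigma> e \<in> {1, -1}" "balanced_signed_graph E \<sigma>"
  shows "\<exists>\<epsilon>. is_potential E \<sigma> \<epsilon>"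
  using assms
proof (induction E)
  case empty
  show ?case by (intro exI[of _ "\<lambda>_. 1"]) (simp add: is_potential_def)
next
  case (insert e E)
  have "balanced_signed_graph E \<sigma>"
    using insert.prems(3) unfolding balanced_signed_graph_def is_cycle_def by auto
  with insert obtain \<epsilon> where \<epsilon>: "is_potential E \<sigma> \<epsilon>" by auto
  have pm: "\<epsilon> w = 1 \<or> \<epsilon> w = -1" for w using \<epsilon> by (auto simp: is_potential_def)
  obtain u v where e: "e = {u, v}" "u \<noteq> v" using insert.prems(1)[of e] by (auto simp: card_2_iff)
  define R where "R = {(x, y). {x, y} \<in> E}"
  have "sym R" by (auto simp: R_def sym_def insert_commute)
  have "irrefl R" using insert.prems(1) by (force simp: R_def irrefl_def)
  show ?case
  proof (cases "(u, v) \<in> R\<^sup>*")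
    case True
    then obtain vs where vs: "vs \<noteq> []" "hd vs = u" "last vs = v" "distinct vs"
      "\<And>j l. j < length vs \<Longrightarrow> l < length vs \<Longrightarrow> (vs ! j, vs ! l) \<in> R \<longleftrightarrow> \<bar>int j - int l\<bar> = 1"
      using rtrancl_imp_induced_path[OF True \<open>sym R\<close> \<open>irrefl R\<close>] by blast
    have edge: "{vs ! k, vs ! Suc k} \<in> E" if "Suc k < length vs" for k
      using vs(5)[of k "Suc k"] that by (simp add: R_def)
    define m where "m = length vs - 1"
    have len: "length vs = Suc m" using vs(1) by (simp add: m_def)
    have ends: "vs ! 0 = u" "vs ! m = v" using vs(1-3) by (auto simp: m_def hd_conv_nth last_conv_nth)
    \<comment> \<open>With \<open>m = 0\<close> the ends would coincide, with \<open>m = 1\<close>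
      the new edge would be an old one; hence the closed path has at least three vertices.\<close>
    have "m \<noteq> 0" using e(2) ends by metis
    moreover have "m \<noteq> 1" using edge[of 0] ends e insert.hyps(2) len by auto
    ultimately have m: "m \<ge> 2" by simp
    have last: "cycle_edge vs m = e" using ends e len by (auto simp: cycle_edge_def)
    have cyc: "cycle_edge vs k = {vs ! k, vs ! Suc k}" if "k < m" for k
      using that len by (simp add: cycle_edge_def)
    have "is_cycle (insert e E) vs"
      unfolding is_cycle_def
    proof (intro conjI allI impI)
      fix k assume "k < length vs"
      then consider "k < m" | "k = m" using len by linarith
      then show "cycle_edge vs k \<in> insert e E"
        by cases (use edge len last cyc in auto)
    qed (use m len vs in auto)
    with insert.prems(3) have "(\<Prod>k<Suc m. \<sigma> (cycle_edge vs k)) > 0"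
      unfolding balanced_signed_graph_def using len by metis
    moreover have "(\<Prod>k<n. \<sigma> (cycle_edge vs k)) = \<epsilon> u * \<epsilon> (vs ! n)" if "n \<le> m" for n
      using that
    proof (induction n)
      case 0
      then show ?case using ends pm[of u] by auto
    next
      case (Suc n)
      then have "\<sigma> (cycle_edge vs n) = \<epsilon> (vs ! n) * \<epsilon> (vs ! Suc n)"
        using edge[of n] len \<epsilon> by (simp add: cyc is_potential_def)
      with Suc pm[of "vs ! n"] show ?case by auto
    qed
    ultimately have "\<epsilon> u * \<epsilon> v * \<sigma> e > 0" by (simp add: last ends)
    then have "\<sigma> e = \<epsilon> u * \<epsilon> v"
      using insert.prems(2)[of e] pm[of u] pm[of v] by auto
    with \<epsilon> have "is_potential (insert e E) \<sigma> \<epsilon>"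
      by (auto simp: is_potential_def e doubleton_eq_iff insert_commute mult.commute)
    then show ?thesis by blast
  next
    case False
    \<comment> \<open>The factor \<open>\<sigma> e * \<epsilon> u * \<epsilon> v\<close> is 1 if
      \<open>e\<close> already agrees with \<open>\<epsilon>\<close> and -1 otherwise. Applied to
      the component of \<open>u\<close>, which misses \<open>v\<close>, it repairs \<open>e\<close>
      and leaves every old edge as it was.\<close>
    define \<epsilon>' where "\<epsilon>' w = (if (u, w) \<in> R\<^sup>* then \<sigma> e * \<epsilon> u * \<epsilon> v * \<epsilon> w else \<epsilon> w)" for w
    have s: "\<sigma> e = 1 \<or> \<sigma> e = -1" using insert.prems(2)[of e] by auto
    have pm': "\<epsilon>' w \<in> {1, -1}" for w
      using s pm[of u] pm[of v] pm[of w] by (auto simp: \<epsilon>'_def)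
    have "\<sigma> {x, y} = \<epsilon>' x * \<epsilon>' y" if "{x, y} \<in> E" for x y
    proof -
      have "(x, y) \<in> R" "(y, x) \<in> R" using that by (auto simp: R_def insert_commute)
      then have "(u, x) \<in> R\<^sup>* \<longleftrightarrow> (u, y) \<in> R\<^sup>*" by (meson rtrancl.rtrancl_into_rtrancl)
      then have "\<epsilon>' x * \<epsilon>' y = \<epsilon> x * \<epsilon> y"
        using s pm[of u] pm[of v] by (auto simp: \<epsilon>'_def)
      with \<epsilon> that show ?thesis by (simp add: is_potential_def)
    qed
    moreover have "\<sigma> e = \<epsilon>' u * \<epsilon>' v"
      using False pm[of u] pm[of v] by (auto simp: \<epsilon>'_def)
    ultimately have "is_potential (insert e E) \<sigma> \<epsilon>'"
      using pm' by (auto simp: is_potential_def e doubleton_eq_iff insert_commute mult.commute)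
    then show ?thesis by blast
  qed
qed

section \<open>Weights and adjacency of faces\<close>

lemma face_subset: "simplicial_complex K \<Longrightarrow> F \<in> K \<Longrightarrow> G \<subseteq> F \<Longrightarrow> G \<in> K"
  by (auto simp: simplicial_complex_def)

lemma finite_face:
  assumes "simplicial_complex K" "F \<in> K"
  shows "finite F"
proof -
  have "Pow F \<subseteq> K" "finite K" using assms by (auto simp: simplicial_complex_def)
  then show ?thesis using finite_Pow_iff finite_subset by metis
qed

lemma finite_vertex_set: "simplicial_complex K \<Longrightarrow> finite (vertex_set K)"
  using finite_face by (auto simp: vertex_set_def simplicial_complex_def)

lemma finite_faces: "simplicial_complex K \<Longrightarrow> finite (faces K i)"
  by (simp add: simplicial_complex_def faces_def)

lemma face_in_facesI: "simplicial_complex K \<Longrightarrow> G \<in> K \<Longrightarrow> F \<subseteq> G \<Longrightarrow> card F = i + 1 \<Longrightarrow> F \<in> faces K i"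
  using face_subset by (auto simp: faces_def)

lemma faces_insertE:
  assumes "simplicial_complex K" "F \<in> faces K i" "G \<in> faces K (i + 1)" "F \<subset> G"
  obtains v where "v \<notin> F" "G = insert v F"
proof -
  have "finite G" "card (G - F) = 1"
    using assms finite_face[of K G] finite_subset[of F G] by (auto simp: faces_def card_Diff_subset)
  then obtain v where "G - F = {v}" by (auto simp: card_1_singleton_iff)
  with assms(4) that[of v] show thesis by blast
qed

text \<open>By downward closure a face properly inside another also lies in one with a single
  additional vertex, so the recursive sum of a non-facet is never empty.\<close>

lemma face_weight_pos:
  assumes "simplicial_complex K" "F \<in> K"
  shows "face_weight K F > 0"
  using assms
proof (induction K F rule: face_weight.induct)
  case (1 K F)
  have fin: "finite K" using "1.prems" by (simp add: simplicial_complex_def)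
  let ?U = "{G \<in> K. F \<subset> G \<and> card G = card F + 1}"
  show ?case
  proof (cases "is_facet K F")
    case True
    with "1.prems" fin show ?thesis by (simp add: face_weight.simps)
  next
    case False
    then obtain H x where H: "H \<in> K" "F \<subset> H" "x \<in> H" "x \<notin> F"
      using "1.prems" by (auto simp: is_facet_def)
    have "insert x F \<in> ?U"
      using H "1.prems" finite_face[of K F] face_subset[of K H "insert x F"] by auto
    then have "?U \<noteq> {}" by blast
    moreover have "\<not> (infinite K \<or> F \<notin> K)" using fin "1.prems" by simp
    then have "face_weight K G > 0" if "G \<in> ?U" for G
      using that by (intro "1.IH"[OF _ False that] "1.prems") auto
    ultimately have "(\<Sum>G\<in>?U. face_weight K G) > 0" using fin by (intro sum_pos) auto
    moreover have "face_weight K F = (\<Sum>G\<in>?U. face_weight K G)"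
      using False fin "1.prems" by (subst face_weight.simps) simp
    ultimately show ?thesis by simp
  qed
qed

text \<open>A face with a coface is no facet, so the recursive clause for the weight applies. It
  makes a row of the Laplacian an average over cofaces.\<close>

lemma sum_coface_weight:
  assumes "simplicial_complex K" "F \<in> faces K i" "{G \<in> faces K (i + 1). F \<subset> G} \<noteq> {}"
  shows "(\<Sum>G\<in>{G \<in> faces K (i + 1). F \<subset> G}. face_weight K G / face_weight K F) = 1"
proof -
  have "{G \<in> faces K (i + 1). F \<subset> G} = {G \<in> K. F \<subset> G \<and> card G = card F + 1}"
    using assms(2) by (auto simp: faces_def)
  moreover have "finite K" "F \<in> K" "\<not> is_facet K F"
    using assms by (auto simp: is_facet_def faces_def simplicial_complex_def)
  ultimately have "face_weight K F = (\<Sum>G\<in>{G \<in> faces K (i + 1). F \<subset> G}. face_weight K G)"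
    by (subst face_weight.simps) simp
  then show ?thesis
    using face_weight_pos[OF assms(1), of F] \<open>F \<in> K\<close> by (simp flip: sum_divide_distrib)
qed

text \<open>The origin of the bound \<open>i + 2\<close>: an \<open>(i+1)\<close>-face has
  \<open>i + 2\<close> vertices and loses one of them.\<close>

lemma card_subfaces:
  assumes "simplicial_complex K" "G \<in> faces K (i + 1)"
  shows "card {F \<in> faces K i. F \<subset> G} = i + 2"
proof -
  have G: "finite G" "card G = i + 2" "G \<in> K" using assms finite_face by (auto simp: faces_def)
  have "{F \<in> faces K i. F \<subset> G} = {F. F \<subseteq> G \<and> card F = i + 1}"
    using G face_subset[OF assms(1)] by (auto simp: faces_def)
  then show ?thesis using G by (simp add: n_subsets binomial_symmetric[of "i + 1" "i + 2"])
qed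

section \<open>Path connectedness as reachability\<close>

text \<open>The graph whose induced paths are the \<open>(i+1)\<close>-paths. It is irreflexive
  because \<open>F \<inter> F\<close> has too many vertices for an \<open>i\<close>-face.\<close>

definition face_adj :: "'a set set \<Rightarrow> nat \<Rightarrow> 'a set rel" where
  "face_adj K i = {(F, G). F \<in> faces K (i + 1) \<and> G \<in> faces K (i + 1) \<and> F \<inter> G \<in> faces K i}"

lemma sym_face_adj: "sym (face_adj K i)"
  by (auto simp: face_adj_def sym_def Int_commute)

lemma up_path_imp_rtrancl:
  assumes "up_path K i Fs"
  shows "(hd Fs, last Fs) \<in> (face_adj K i)\<^sup>*"
proof -
  have mem: "Fs ! j \<in> faces K (i + 1)" if "j < length Fs" for j
    using assms nth_mem[OF that] unfolding up_path_def by blast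
  have "(Fs ! 0, Fs ! n) \<in> (face_adj K i)\<^sup>*" if "n < length Fs" for n
    using that
  proof (induction n)
    case (Suc n)
    have "Fs ! n \<inter> Fs ! Suc n \<in> faces K i \<longleftrightarrow> \<bar>int n - int (Suc n)\<bar> = 1"
      using assms Suc.prems Suc_lessD unfolding up_path_def by blast
    with Suc.prems mem[of n] mem[of "Suc n"] have "(Fs ! n, Fs ! Suc n) \<in> face_adj K i"
      by (simp add: face_adj_def)
    with Suc.IH Suc.prems show ?case by (simp add: rtrancl.rtrancl_into_rtrancl)
  qed simp
  moreover have "Fs \<noteq> []" using assms by (simp add: up_path_def)
  ultimately show ?thesis by (simp add: hd_conv_nth last_conv_nth)
qed

lemma rtrancl_imp_up_path:
  assumes "(F, G) \<in> (face_adj K i)\<^sup>*" "F \<in> faces K (i + 1)"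
  shows "\<exists>Fs. up_path K i Fs \<and> hd Fs = F \<and> last Fs = G"
proof -
  have irr: "irrefl (face_adj K i)" by (simp add: face_adj_def irrefl_def faces_def)
  obtain Fs where Fs: "Fs \<noteq> []" "hd Fs = F" "last Fs = G"
    "\<And>j l. j < length Fs \<Longrightarrow> l < length Fs \<Longrightarrow> (Fs ! j, Fs ! l) \<in> face_adj K i \<longleftrightarrow> \<bar>int j - int l\<bar> = 1"
    by (rule rtrancl_imp_induced_path[OF assms(1) sym_face_adj irr that])
  have mem: "Fs ! j \<in> faces K (i + 1)" if j: "j < length Fs" for j
  proof (cases j)
    case 0
    with Fs(1,2) assms(2) show ?thesis by (simp add: hd_conv_nth)
  next
    case (Suc m)
    then have "(Fs ! m, Fs ! j) \<in> face_adj K i" using Fs(4)[of m j] j by simp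
    then show ?thesis by (simp add: face_adj_def)
  qed
  have "Fs ! j \<inter> Fs ! l \<in> faces K i \<longleftrightarrow> \<bar>int j - int l\<bar> = 1" if "j < length Fs" "l < length Fs" for j l
    unfolding Fs(4)[OF that, symmetric] using mem[OF that(1)] mem[OF that(2)] by (simp add: face_adj_def)
  moreover have "set Fs \<subseteq> faces K (i + 1)"
  proof
    fix H assume "H \<in> set Fs"
    then obtain j where "j < length Fs" "H = Fs ! j" by (auto simp: in_set_conv_nth)
    with mem show "H \<in> faces K (i + 1)" by simp
  qed
  ultimately have "up_path K i Fs" using Fs(1) by (simp add: up_path_def)
  with Fs(2,3) show ?thesis by blast
qed

lemma up_path_connected_iff_rtrancl:
  "up_path_connected K i \<longleftrightarrow> (\<forall>F\<in>faces K (i + 1). \<forall>G\<in>faces K (i + 1). (F, G) \<in> (face_adj K i)\<^sup>*)"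
proof
  assume "up_path_connected K i"
  then show "\<forall>F\<in>faces K (i + 1). \<forall>G\<in>faces K (i + 1). (F, G) \<in> (face_adj K i)\<^sup>*"
    unfolding up_path_connected_def using up_path_imp_rtrancl by fast
next
  assume "\<forall>F\<in>faces K (i + 1). \<forall>G\<in>faces K (i + 1). (F, G) \<in> (face_adj K i)\<^sup>*"
  then show "up_path_connected K i"
    unfolding up_path_connected_def using rtrancl_imp_up_path by blast
qed

section \<open>Potentials on the incidence graph\<close>

text \<open>The sign function \<open>s\<close> is left open, so that incidence signs of any
  orientation and order signs can be compared. One function serves both sides of the bipartite
  graph, since cardinality separates them.\<close>

definition face_potential :: "'a set set \<Rightarrow> nat \<Rightarrow> ('a set \<Rightarrow> 'a set \<Rightarrow> real) \<Rightarrow> ('a set \<Rightarrow> real) \<Rightarrow> bool" where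
  "face_potential K i s \<epsilon> \<longleftrightarrow> (\<forall>F. \<epsilon> F \<in> {1, -1}) \<and>
     (\<forall>F\<in>faces K i. \<forall>G\<in>faces K (i + 1). F \<subset> G \<longrightarrow> s F G = \<epsilon> F * \<epsilon> G)"

lemma incidence_edgesE:
  assumes "e \<in> incidence_edges K i"
  obtains F G where "F \<in> faces K i" "G \<in> faces K (i + 1)" "F \<subset> G" "e = {F, G}"
  using assms unfolding incidence_edges_def by blast

lemma incidence_graph_balanced_iff_potential:
  assumes "simplicial_complex K"
  shows "incidence_graph_balanced K \<omega> i \<longleftrightarrow> (\<exists>\<epsilon>. face_potential K i (incidence_sgn \<omega>) \<epsilon>)"
proof -
  let ?E = "incidence_edges K i"
  have sgn: "edge_sgn \<omega> {F, G} = incidence_sgn \<omega> F G" if "F \<subset> G" for F G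
    using that by (simp add: edge_sgn_def Int_absorb2 Un_absorb1 psubset_imp_subset)
  have "finite ?E"
  proof (rule finite_subset)
    show "?E \<subseteq> (\<lambda>(F, G). {F, G}) ` (faces K i \<times> faces K (i + 1))"
      by (auto elim!: incidence_edgesE)
  qed (use finite_faces[OF assms] in blast)
  moreover have "card e = 2" if "e \<in> ?E" for e
  proof -
    from that obtain F G where "e = {F, G}" "F \<subset> G" by (elim incidence_edgesE)
    then show ?thesis by auto
  qed
  moreover have "edge_sgn \<omega> e \<in> {1, -1}" for e
    unfolding edge_sgn_def by (rule incidence_sgn_pm1)
  ultimately have "incidence_graph_balanced K \<omega> i \<longleftrightarrow> (\<exists>\<epsilon>. is_potential ?E (edge_sgn \<omega>) \<epsilon>)"
    unfolding incidence_graph_balanced_def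
    using balanced_imp_potential[of ?E "edge_sgn \<omega>"] potential_imp_balanced[of ?E "edge_sgn \<omega>"] by metis
  moreover have "is_potential ?E (edge_sgn \<omega>) \<epsilon> \<longleftrightarrow> face_potential K i (incidence_sgn \<omega>) \<epsilon>" for \<epsilon>
  proof
    assume p: "is_potential ?E (edge_sgn \<omega>) \<epsilon>"
    show "face_potential K i (incidence_sgn \<omega>) \<epsilon>"
      unfolding face_potential_def
    proof (intro conjI ballI impI)
      fix F G assume "F \<in> faces K i" "G \<in> faces K (i + 1)" "F \<subset> G"
      then have "{F, G} \<in> ?E" unfolding incidence_edges_def by blast
      with p have "edge_sgn \<omega> {F, G} = \<epsilon> F * \<epsilon> G" by (simp add: is_potential_def)
      with sgn[OF \<open>F \<subset> G\<close>] show "incidence_sgn \<omega> F G = \<epsilon> F * \<epsilon> G" by simp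
    qed (use p in \<open>simp add: is_potential_def\<close>)
  next
    assume p: "face_potential K i (incidence_sgn \<omega>) \<epsilon>"
    have "edge_sgn \<omega> {F, G} = \<epsilon> F * \<epsilon> G" if e: "{F, G} \<in> ?E" for F G
    proof -
      obtain F' G' where F': "F' \<in> faces K i" "G' \<in> faces K (i + 1)" "F' \<subset> G'"
        and eq: "{F, G} = {F', G'}" using e by (elim incidence_edgesE)
      have "edge_sgn \<omega> {F, G} = \<epsilon> F' * \<epsilon> G'"
        using p F' by (simp add: eq sgn face_potential_def)
      with eq show ?thesis by (auto simp: doubleton_eq_iff)
    qed
    with p show "is_potential ?E (edge_sgn \<omega>) \<epsilon>"
      unfolding is_potential_def face_potential_def by blast
  qed
  ultimately show ?thesis by simp
qed

text \<open>The two sign functions differ by a factor from \<open>F\<close> times a factor from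
  \<open>G\<close>, which \<open>\<epsilon>\<close> absorbs. As the right side does not mention
  \<open>\<omega>\<close>, potentials exist for all orientations or for none.\<close>

lemma potential_incidence_sgn_iff_order_sgn:
  assumes "simplicial_complex K" "orientation K \<omega>" "\<And>F. F \<in> K \<Longrightarrow> inj_on \<rho> F"
  shows "(\<exists>\<epsilon>. face_potential K i (incidence_sgn \<omega>) \<epsilon>) \<longleftrightarrow> (\<exists>\<epsilon>. face_potential K i (order_sgn \<rho>) \<epsilon>)"
proof -
  let ?s = "\<lambda>F. inv_sgn \<rho> (\<omega> F)"
  have s: "?s F = 1 \<or> ?s F = -1" for F using inv_sgn_pm1[of \<rho> "\<omega> F"] by auto
  have sgn: "incidence_sgn \<omega> F G = ?s F * ?s G * order_sgn \<rho> F G"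
    if FG: "F \<in> faces K i" "G \<in> faces K (i + 1)" "F \<subset> G" for F G
  proof -
    obtain v where v: "v \<notin> F" "G = insert v F" using faces_insertE[OF assms(1) FG] by blast
    then show ?thesis
      using incidence_sgn_conv_order_sgn[OF assms(2), of F v \<rho>] FG assms(3)[of G] by (simp add: faces_def)
  qed
  have "face_potential K i (order_sgn \<rho>) (\<lambda>F. ?s F * \<epsilon> F)"
    if p: "face_potential K i (incidence_sgn \<omega>) \<epsilon>" for \<epsilon>
    unfolding face_potential_def
  proof (intro conjI ballI impI allI)
    fix F show "?s F * \<epsilon> F \<in> {1, -1}" using p s[of F] by (auto simp: face_potential_def)
  next
    fix F G assume FG: "F \<in> faces K i" "G \<in> faces K (i + 1)" "F \<subset> G"
    with p have "?s F * ?s G * order_sgn \<rho> F G = \<epsilon> F * \<epsilon> G"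
      by (simp add: sgn[OF FG, symmetric] face_potential_def)
    then show "order_sgn \<rho> F G = ?s F * \<epsilon> F * (?s G * \<epsilon> G)" using s[of F] s[of G] by auto
  qed
  moreover have "face_potential K i (incidence_sgn \<omega>) (\<lambda>F. ?s F * \<epsilon> F)"
    if p: "face_potential K i (order_sgn \<rho>) \<epsilon>" for \<epsilon>
    unfolding face_potential_def
  proof (intro conjI ballI impI allI)
    fix F show "?s F * \<epsilon> F \<in> {1, -1}" using p s[of F] by (auto simp: face_potential_def)
  next
    fix F G assume FG: "F \<in> faces K i" "G \<in> faces K (i + 1)" "F \<subset> G"
    with p show "incidence_sgn \<omega> F G = ?s F * \<epsilon> F * (?s G * \<epsilon> G)"
      by (simp add: sgn[OF FG] face_potential_def)
  qed
  ultimately show ?thesis by blast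
qed

section \<open>The spectrum of the up Laplacian\<close>

text \<open>Enumerating \<open>S\<close> turns the operator into a matrix, whose eigenvalues are
  roots of its monic characteristic polynomial. Finiteness gives \<open>Max\<close> in
  \<open>lambda_max\<close> its meaning.\<close>

lemma finite_real_eigenvalues:
  fixes M :: "'b \<Rightarrow> 'b \<Rightarrow> real"
  assumes "finite S"
  shows "finite {\<mu>. \<exists>f. (\<exists>x\<in>S. f x \<noteq> 0) \<and> (\<forall>x\<in>S. (\<Sum>y\<in>S. M x y * f y) = \<mu> * f x)}" (is "finite ?E")
proof -
  define n where "n = card S"
  obtain h where h: "bij_betw h {0..<n} S"
    using ex_bij_betw_nat_finite[OF assms] by (auto simp: n_def)
  define A where "A = mat n n (\<lambda>(j, k). M (h j) (h k))"
  have A: "A \<in> carrier_mat n n" by (simp add: A_def)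
  have "char_poly A \<noteq> 0" using degree_monic_char_poly[OF A] by auto
  then have "finite {\<mu>. poly (char_poly A) \<mu> = 0}" by (rule poly_roots_finite)
  moreover have "poly (char_poly A) \<mu> = 0" if "\<mu> \<in> ?E" for \<mu>
  proof -
    from that obtain f x where f: "x \<in> S" "f x \<noteq> 0"
      "\<And>x. x \<in> S \<Longrightarrow> (\<Sum>y\<in>S. M x y * f y) = \<mu> * f x" by blast
    have S: "S = h ` {0..<n}" using h by (simp add: bij_betw_def)
    have sum: "(\<Sum>y\<in>S. M (h j) y * f y) = (\<Sum>k=0..<n. M (h j) (h k) * f (h k))" for j
      using sum.reindex_bij_betw[OF h, of "\<lambda>y. M (h j) y * f y"] by simp
    define v where "v = vec n (\<lambda>k. f (h k))"
    have "v \<noteq> 0\<^sub>v n"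
    proof
      assume "v = 0\<^sub>v n"
      then have "f (h k) = 0" if "k < n" for k using that by (auto simp: v_def dest!: arg_cong[of _ _ "\<lambda>v. v $ k"])
      with f S show False by auto
    qed
    moreover have "A *\<^sub>v v = \<mu> \<cdot>\<^sub>v v"
    proof (rule eq_vecI)
      fix j assume "j < dim_vec (\<mu> \<cdot>\<^sub>v v)"
      then have "j < n" by (simp add: v_def)
      then show "(A *\<^sub>v v) $ j = (\<mu> \<cdot>\<^sub>v v) $ j"
        using f(3)[of "h j"] sum[of j] S by (simp add: A_def v_def scalar_prod_def)
    qed (simp add: A_def v_def)
    ultimately have "eigenvalue A \<mu>" using A unfolding eigenvalue_def eigenvector_def
      by (intro exI[of _ v]) (simp add: v_def)
    then show ?thesis using eigenvalue_root_char_poly[OF A] by simp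
  qed
  then have "?E \<subseteq> {\<mu>. poly (char_poly A) \<mu> = 0}" by blast
  ultimately show ?thesis by (rule rev_finite_subset)
qed

text \<open>The operator factors as the coboundary followed by its weighted adjoint. The
  off-diagonal sum is regrouped by the coface \<open>F \<union> F'\<close>, and the diagonal is the
  term \<open>F' = F\<close>, where the signs square to 1.\<close>

lemma up_laplacian_conv_boundary:
  assumes "simplicial_complex K" "F \<in> faces K i"
  shows "up_laplacian K \<omega> i f F =
    (\<Sum>G\<in>{G \<in> faces K (i + 1). F \<subset> G}. face_weight K G / face_weight K F *
      (incidence_sgn \<omega> F G * (\<Sum>F'\<in>{F' \<in> faces K i. F' \<subset> G}. incidence_sgn \<omega> F' G * f F')))"
proof -
  let ?U = "{G \<in> faces K (i + 1). F \<subset> G}" and ?D = "\<lambda>G. {F' \<in> faces K i. F' \<subset> G}"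
  let ?w = "\<lambda>G. face_weight K G / face_weight K F"
  let ?t = "\<lambda>G F'. ?w G * incidence_sgn \<omega> F G * incidence_sgn \<omega> F' G * f F'"
  note fin = finite_faces[OF assms(1)]
  have un: "F \<union> F' = G" if "G \<in> ?U" "F' \<in> ?D G" "F' \<noteq> F" for F' G
  proof (rule card_seteq)
    have "finite F'" "finite F" using assms that finite_face by (auto simp: faces_def)
    moreover from this have "\<not> F' \<subseteq> F" using that assms(2) by (auto simp: faces_def dest: card_subset_eq)
    ultimately have "card F < card (F \<union> F')" by (intro psubset_card_mono) auto
    with that assms(2) show "card G \<le> card (F \<union> F')" by (auto simp: faces_def)
    show "finite G" using assms(1) that finite_face by (auto simp: faces_def)
  qed (use that in auto)
  have "(\<Sum>F'\<in>{F' \<in> faces K i. F' \<noteq> F \<and> F \<union> F' \<in> faces K (i + 1)}. ?t (F \<union> F') F') =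
      (\<Sum>(G, F')\<in>Sigma ?U (\<lambda>G. ?D G - {F}). ?t G F')"
  proof (rule sum.reindex_bij_witness[where i = snd and j = "\<lambda>F'. (F \<union> F', F')"])
    fix F' assume F': "F' \<in> {F' \<in> faces K i. F' \<noteq> F \<and> F \<union> F' \<in> faces K (i + 1)}"
    then have "F \<noteq> F \<union> F'" "F' \<noteq> F \<union> F'" using assms(2) by (auto simp: faces_def)
    then have "F \<subset> F \<union> F'" "F' \<subset> F \<union> F'" by blast+
    with F' show "(F \<union> F', F') \<in> Sigma ?U (\<lambda>G. ?D G - {F})" by simp
  next
    fix b assume "b \<in> Sigma ?U (\<lambda>G. ?D G - {F})"
    then obtain G F' where b: "b = (G, F')" "G \<in> ?U" "F' \<in> ?D G" "F' \<noteq> F" by blast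
    from un[OF b(2-4)] b show "(F \<union> snd b, snd b) = b"
      "snd b \<in> {F' \<in> faces K i. F' \<noteq> F \<and> F \<union> F' \<in> faces K (i + 1)}" by simp_all
  qed simp_all
  also have "\<dots> = (\<Sum>G\<in>?U. \<Sum>F'\<in>?D G - {F}. ?t G F')"
    using fin by (subst sum.Sigma) auto
  finally have "up_laplacian K \<omega> i f F = (\<Sum>G\<in>?U. ?w G * f F + (\<Sum>F'\<in>?D G - {F}. ?t G F'))"
    by (simp add: up_laplacian_def sum.distrib)
  also have "\<dots> = (\<Sum>G\<in>?U. ?w G * (incidence_sgn \<omega> F G * (\<Sum>F'\<in>?D G. incidence_sgn \<omega> F' G * f F')))"
  proof (rule sum.cong[OF refl])
    fix G assume G: "G \<in> ?U"
    have "?t G F = ?w G * f F" using incidence_sgn_pm1[of \<omega> F G] by auto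
    moreover have "(\<Sum>F'\<in>?D G. ?t G F') = ?t G F + (\<Sum>F'\<in>?D G - {F}. ?t G F')"
      using G assms(2) fin by (intro sum.remove) auto
    ultimately show "?w G * f F + (\<Sum>F'\<in>?D G - {F}. ?t G F') =
        ?w G * (incidence_sgn \<omega> F G * (\<Sum>F'\<in>?D G. incidence_sgn \<omega> F' G * f F'))"
      by (simp add: sum_distrib_left mult.assoc)
  qed
  finally show ?thesis .
qed

lemma finite_up_eigenvalues:
  assumes "simplicial_complex K"
  shows "finite {\<mu>. up_eigenvalue K \<omega> i \<mu>}"
proof -
  define M where "M F F' = (\<Sum>G\<in>{G \<in> faces K (i + 1). F \<subset> G}.
    if F' \<subset> G then face_weight K G / face_weight K F * (incidence_sgn \<omega> F G * incidence_sgn \<omega> F' G) else 0)"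
    for F F'
  have "up_laplacian K \<omega> i f F = (\<Sum>F'\<in>faces K i. M F F' * f F')" if "F \<in> faces K i" for f F
  proof -
    let ?c = "\<lambda>G F'. face_weight K G / face_weight K F * (incidence_sgn \<omega> F G * incidence_sgn \<omega> F' G)"
    have "(\<Sum>F'\<in>faces K i. M F F' * f F') =
        (\<Sum>G\<in>{G \<in> faces K (i + 1). F \<subset> G}. \<Sum>F'\<in>faces K i. (if F' \<subset> G then ?c G F' else 0) * f F')"
      unfolding M_def sum_distrib_right by (rule sum.swap)
    also have "\<dots> = (\<Sum>G\<in>{G \<in> faces K (i + 1). F \<subset> G}. \<Sum>F'\<in>{F' \<in> faces K i. F' \<subset> G}. ?c G F' * f F')"
      unfolding sum.inter_filter[OF finite_faces[OF assms]]
      by (intro sum.cong refl if_cong) simp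
    also have "\<dots> = up_laplacian K \<omega> i f F"
      unfolding up_laplacian_conv_boundary[OF assms that] by (simp add: sum_distrib_left mult.assoc)
    finally show ?thesis by simp
  qed
  then have "{\<mu>. up_eigenvalue K \<omega> i \<mu>} = {\<mu>. \<exists>f. (\<exists>F\<in>faces K i. f F \<noteq> 0) \<and>
      (\<forall>F\<in>faces K i. (\<Sum>F'\<in>faces K i. M F F' * f F') = \<mu> * f F)}"
    by (simp add: up_eigenvalue_def)
  then show ?thesis using finite_real_eigenvalues[OF finite_faces[OF assms]] by simp
qed

text \<open>The coboundary of an \<open>(i-1)\<close>-face lies in the kernel. This is needed because
  \<^const>\<open>Max\<close> in \<^const>\<open>lambda_max\<close> is unspecified on the empty set.\<close>

lemma zero_up_eigenvalue:
  assumes K: "simplicial_complex K" and "orientation K \<omega>" and "faces K i \<noteq> {}"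
  shows "up_eigenvalue K \<omega> i 0"
proof -
  obtain \<rho> :: "'a \<Rightarrow> nat" where \<rho>: "inj_on \<rho> (vertex_set K)"
    using finite_imp_inj_to_nat_seg[OF finite_vertex_set[OF K]] by auto
  have inj: "inj_on \<rho> F" if "F \<in> K" for F
    using \<rho> that by (auto simp: vertex_set_def intro: inj_on_subset)
  obtain F\<^sub>0 where F\<^sub>0: "F\<^sub>0 \<in> faces K i" using assms(3) by blast
  then have "F\<^sub>0 \<noteq> {}" by (auto simp: faces_def)
  then obtain x where "x \<in> F\<^sub>0" by blast
  \<comment> \<open>An \<open>(i-1)\<close>-face, empty if \<open>i = 0\<close>.\<close>
  define E where "E = F\<^sub>0 - {x}"
  have E: "finite E" "card E = i" "E \<subset> F\<^sub>0"
    using F\<^sub>0 \<open>x \<in> F\<^sub>0\<close> finite_face[OF K, of F\<^sub>0] by (auto simp: E_def faces_def)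
  \<comment> \<open>On \<open>i\<close>-faces, and up to the constant sign
    \<open>inv_sgn \<rho> (\<omega> E)\<close>, the coboundary of the indicator function of
    \<open>E\<close>.\<close>
  define f where "f F = (if E \<subset> F then inv_sgn \<rho> (\<omega> F) * order_sgn \<rho> E F else 0)" for F
  define P where "P v = (\<Prod>u\<in>E. if \<rho> u < \<rho> v then -1 else 1 :: real)" for v
  have order_E: "order_sgn \<rho> E (insert v E) = P v" if "v \<notin> E" for v
  proof -
    have "insert v E - E = {v}" using that by auto
    then show ?thesis by (simp add: order_sgn_def P_def)
  qed
  \<comment> \<open>The coboundary applied twice vanishes: if \<open>E\<close> lies in
    \<open>G\<close>, exactly two \<open>i\<close>-faces lie between them, and their contributions
    cancel.\<close>
  have boundary: "(\<Sum>F\<in>{F \<in> faces K i. F \<subset> G}. incidence_sgn \<omega> F G * f F) = 0"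
    if G: "G \<in> faces K (i + 1)" for G
  proof (cases "E \<subseteq> G")
    case False
    then show ?thesis by (intro sum.neutral) (auto simp: f_def)
  next
    case True
    have GK: "G \<in> K" "finite G" "card G = i + 2" using G finite_face[OF K] by (auto simp: faces_def)
    with E True have "card (G - E) = 2" by (simp add: card_Diff_subset)
    then obtain a b where ab: "G - E = {a, b}" "a \<noteq> b" by (auto simp: card_2_iff)
    then have nin: "a \<notin> E" "b \<notin> E" and Gab: "G = insert b (insert a E)" "G = insert a (insert b E)"
      using True by auto
    have sub: "insert a E \<in> faces K i" "insert b E \<in> faces K i"
      using GK E nin Gab by (auto intro!: face_in_facesI[OF K, of G])
    have eq: "{F \<in> faces K i. F \<subset> G \<and> E \<subset> F} = {insert a E, insert b E}"
    proof (intro equalityI subsetI)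
      fix F assume F: "F \<in> {F \<in> faces K i. F \<subset> G \<and> E \<subset> F}"
      then obtain y where "y \<in> F" "y \<notin> E" by auto
      with F ab have "y \<in> {a, b}" by auto
      moreover have "F = insert y E"
        using F E finite_face[OF K, of F] \<open>y \<in> F\<close> \<open>y \<notin> E\<close>
        by (intro card_subset_eq[symmetric]) (auto simp: faces_def)
      ultimately show "F \<in> {insert a E, insert b E}" by auto
    next
      fix F assume "F \<in> {insert a E, insert b E}"
      with sub nin ab(2) Gab show "F \<in> {F \<in> faces K i. F \<subset> G \<and> E \<subset> F}" by auto
    qed
    \<comment> \<open>Exchanging \<open>y\<close> and \<open>z\<close> changes only the comparison
      of \<open>\<rho> y\<close> with \<open>\<rho> z\<close>, hence the sign.\<close>
    have summand: "incidence_sgn \<omega> (insert y E) G * f (insert y E) =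
        inv_sgn \<rho> (\<omega> G) * ((if \<rho> y < \<rho> z then -1 else 1) * P z * P y)"
      if "G = insert z (insert y E)" "y \<notin> E" "z \<notin> insert y E" "insert y E \<in> faces K i" for y z
    proof -
      have "incidence_sgn \<omega> (insert y E) G =
          inv_sgn \<rho> (\<omega> (insert y E)) * inv_sgn \<rho> (\<omega> G) * order_sgn \<rho> (insert y E) G"
        using incidence_sgn_conv_order_sgn[OF assms(2), of "insert y E" z \<rho>] that GK inj[of G]
        by (simp add: faces_def)
      moreover have "order_sgn \<rho> (insert y E) G = (if \<rho> y < \<rho> z then -1 else 1) * P z"
      proof -
        have "G - insert y E = {z}" using that by auto
        then show ?thesis using E that(2) by (simp add: order_sgn_def P_def)
      qed
      moreover have "f (insert y E) = inv_sgn \<rho> (\<omega> (insert y E)) * P y"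
        using that(2) order_E by (auto simp: f_def)
      ultimately show ?thesis using inv_sgn_pm1[of \<rho> "\<omega> (insert y E)"] by auto
    qed
    have "\<rho> a \<noteq> \<rho> b" using inj[OF GK(1)] ab by (auto simp: inj_on_def)
    have "(\<Sum>F\<in>{F \<in> faces K i. F \<subset> G}. incidence_sgn \<omega> F G * f F) =
        (\<Sum>F\<in>{F \<in> faces K i. F \<subset> G \<and> E \<subset> F}. incidence_sgn \<omega> F G * f F)"
      using finite_faces[OF K] by (intro sum.mono_neutral_right) (auto simp: f_def)
    also have "\<dots> = incidence_sgn \<omega> (insert a E) G * f (insert a E) +
        incidence_sgn \<omega> (insert b E) G * f (insert b E)"
      unfolding eq using nin ab(2) by (subst sum.insert) auto
    also have "\<dots> = 0"
      using summand[OF Gab(1)] summand[OF Gab(2)] nin ab(2) sub \<open>\<rho> a \<noteq> \<rho> b\<close> by auto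
    finally show ?thesis .
  qed
  have "order_sgn \<rho> E F\<^sub>0 \<noteq> 0"
    using E F\<^sub>0 finite_face[OF K, of F\<^sub>0] by (auto simp: order_sgn_def faces_def)
  then have "f F\<^sub>0 \<noteq> 0"
    using E(3) inv_sgn_pm1[of \<rho> "\<omega> F\<^sub>0"] by (auto simp: f_def)
  moreover have "up_laplacian K \<omega> i f F = 0 * f F" if "F \<in> faces K i" for F
    unfolding up_laplacian_conv_boundary[OF K that] by (simp add: boundary)
  ultimately show ?thesis using F\<^sub>0 unfolding up_eigenvalue_def by blast
qed

text \<open>The maximum principle: row \<open>F\<close> of the Laplacian is a sum of \<open>i + 2\<close> terms of modulus
  at most \<open>\<bar>f F\<bar>\<close>, averaged over the cofaces of \<open>F\<close>.\<close>

lemma maximal_row: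
  assumes K: "simplicial_complex K" and F: "F \<in> faces K i" "f F \<noteq> 0"
    and max: "\<And>F'. F' \<in> faces K i \<Longrightarrow> \<bar>f F'\<bar> \<le> \<bar>f F\<bar>"
    and row: "up_laplacian K \<omega> i f F = \<mu> * f F"
  shows "\<mu> \<le> real i + 2"
    and "\<mu> = real i + 2 \<Longrightarrow> \<exists>G\<in>faces K (i + 1). F \<subset> G"
    and "\<mu> = real i + 2 \<Longrightarrow> G \<in> faces K (i + 1) \<Longrightarrow> F \<subset> G \<Longrightarrow> F' \<in> faces K i \<Longrightarrow> F' \<subset> G \<Longrightarrow>
      incidence_sgn \<omega> F' G * f F' = incidence_sgn \<omega> F G * f F"
proof -
  let ?U = "{G \<in> faces K (i + 1). F \<subset> G}" and ?D = "\<lambda>G. {F' \<in> faces K i. F' \<subset> G}"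
  define a where "a G = face_weight K G / face_weight K F" for G
  \<comment> \<open>The factor \<open>sgn (f F)\<close> aligns the row, so that maximality bounds
    every summand by \<open>\<bar>f F\<bar>\<close>.\<close>
  define t where "t G F' = sgn (f F) * (incidence_sgn \<omega> F G * (incidence_sgn \<omega> F' G * f F'))" for G F'
  have a: "a G > 0" if "G \<in> ?U" for G
    using that F face_weight_pos[OF K] by (simp add: a_def faces_def)
  have t: "t G F' \<le> \<bar>f F\<bar>" if "F' \<in> faces K i" for G F'
    using max[OF that] incidence_sgn_pm1[of \<omega> F G] incidence_sgn_pm1[of \<omega> F' G]
    by (auto simp: t_def sgn_if split: if_splits)
  \<comment> \<open>The weighted total slack of these bounds. If cofaces exist, the weights sum to 1
    and \<open>S\<close> equals \<open>(i + 2 - \<mu>) * \<bar>f F\<bar>\<close>; without cofaces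
    the row vanishes and \<open>\<mu> = 0\<close>.\<close>
  define S where "S = (\<Sum>G\<in>?U. a G * (\<Sum>F'\<in>?D G. \<bar>f F\<bar> - t G F'))"
  have nonneg: "(\<Sum>F'\<in>?D G. \<bar>f F\<bar> - t G F') \<ge> 0" for G
    using t by (intro sum_nonneg) auto
  have S_nonneg: "S \<ge> 0" unfolding S_def
  proof (rule sum_nonneg)
    fix G assume "G \<in> ?U"
    from a[OF this] nonneg[of G] show "0 \<le> a G * (\<Sum>F'\<in>?D G. \<bar>f F\<bar> - t G F')" by simp
  qed
  have "\<mu> * \<bar>f F\<bar> = sgn (f F) * up_laplacian K \<omega> i f F"
    unfolding row by (simp add: abs_sgn mult_ac)
  also have "\<dots> = (\<Sum>G\<in>?U. a G * (\<Sum>F'\<in>?D G. t G F'))"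
    unfolding up_laplacian_conv_boundary[OF K F(1)] t_def a_def sum_distrib_left by (simp add: mult_ac)
  finally have \<mu>: "\<mu> * \<bar>f F\<bar> = (\<Sum>G\<in>?U. a G * (\<Sum>F'\<in>?D G. t G F'))" .
  have "S = (\<Sum>G\<in>?U. a G * ((real i + 2) * \<bar>f F\<bar>) - a G * (\<Sum>F'\<in>?D G. t G F'))"
    unfolding S_def
    by (rule sum.cong) (simp_all add: sum_subtractf card_subfaces[OF K] right_diff_distrib)
  then have S: "S = (\<Sum>G\<in>?U. a G) * ((real i + 2) * \<bar>f F\<bar>) - \<mu> * \<bar>f F\<bar>"
    by (simp add: \<mu> sum_subtractf sum_distrib_right)
  show "\<mu> \<le> real i + 2"
  proof (cases "?U = {}")
    case True
    have "\<mu> * \<bar>f F\<bar> = 0" by (simp only: \<mu> True sum.empty)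
    with F(2) show ?thesis by simp
  next
    case False
    then have "(\<Sum>G\<in>?U. a G) = 1" unfolding a_def by (rule sum_coface_weight[OF K F(1)])
    with S S_nonneg F(2) show ?thesis by simp
  qed
  assume eq: "\<mu> = real i + 2"
  have ne: "?U \<noteq> {}"
  proof
    assume U: "?U = {}"
    have "\<mu> * \<bar>f F\<bar> = 0" by (simp only: \<mu> U sum.empty)
    with F(2) eq show False by simp
  qed
  then show "\<exists>G\<in>faces K (i + 1). F \<subset> G" by blast
  assume G: "G \<in> faces K (i + 1)" "F \<subset> G" and F': "F' \<in> faces K i" "F' \<subset> G"
  have "(\<Sum>G\<in>?U. a G) = 1" unfolding a_def by (rule sum_coface_weight[OF K F(1) ne])
  \<comment> \<open>For \<open>\<mu> = i + 2\<close> the slack is 0, so each of its nonnegative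
    summands vanishes and every bound is attained.\<close>
  with S eq have "(\<Sum>G\<in>?U. a G * (\<Sum>F'\<in>?D G. \<bar>f F\<bar> - t G F')) = 0" by (simp add: S_def)
  moreover have nn: "0 \<le> a G * (\<Sum>F'\<in>?D G. \<bar>f F\<bar> - t G F')" if "G \<in> ?U" for G
    using a[OF that] nonneg[of G] by simp
  have fin: "finite ?U" "finite (?D G)" using finite_faces[OF K] by simp_all
  ultimately have "\<forall>G\<in>?U. a G * (\<Sum>F'\<in>?D G. \<bar>f F\<bar> - t G F') = 0"
    by (simp only: sum_nonneg_eq_0_iff[OF fin(1) nn])
  moreover have "G \<in> ?U" using G by simp
  ultimately have "(\<Sum>F'\<in>?D G. \<bar>f F\<bar> - t G F') = 0" using a[of G] by fastforce
  moreover have "0 \<le> \<bar>f F\<bar> - t G F'" if "F' \<in> ?D G" for F' using t[of F' G] that by simp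
  ultimately have "\<forall>F'\<in>?D G. \<bar>f F\<bar> - t G F' = 0"
    using fin(2) sum_nonneg_eq_0_iff[of "?D G" "\<lambda>F'. \<bar>f F\<bar> - t G F'"] by simp
  with F' have "t G F' = \<bar>f F\<bar>" by auto
  then show "incidence_sgn \<omega> F' G * f F' = incidence_sgn \<omega> F G * f F"
    using F(2) incidence_sgn_pm1[of \<omega> F G] by (auto simp: t_def sgn_if split: if_splits)
qed

section \<open>The eigenvalue \<open>i + 2\<close> and potentials\<close>

lemma exists_maximal_face:
  assumes "simplicial_complex K" "\<exists>F\<in>faces K i. f F \<noteq> (0 :: real)"
  obtains F where "F \<in> faces K i" "f F \<noteq> 0" "\<And>F'. F' \<in> faces K i \<Longrightarrow> \<bar>f F'\<bar> \<le> \<bar>f F\<bar>"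
proof -
  let ?A = "(\<lambda>F. \<bar>f F\<bar>) ` faces K i"
  have fin: "finite ?A" "?A \<noteq> {}" using finite_faces[OF assms(1)] assms(2) by auto
  then have "Max ?A \<in> ?A" by (rule Max_in)
  then obtain F where F: "F \<in> faces K i" "Max ?A = \<bar>f F\<bar>" by (elim imageE)
  with fin have "\<bar>f F'\<bar> \<le> \<bar>f F\<bar>" if "F' \<in> faces K i" for F'
    using that Max_ge[of ?A "\<bar>f F'\<bar>"] by auto
  moreover have "f F \<noteq> 0"
  proof
    assume "f F = 0"
    with calculation have "f F' = 0" if "F' \<in> faces K i" for F' using that by fastforce
    with assms(2) show False by blast
  qed
  ultimately show thesis by (intro that[OF F(1)])
qed

lemma up_eigenvalue_le:
  assumes "simplicial_complex K" "up_eigenvalue K \<omega> i \<mu>"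
  shows "\<mu> \<le> real i + 2"
proof -
  obtain f where f: "\<exists>F\<in>faces K i. f F \<noteq> 0"
    "\<And>F. F \<in> faces K i \<Longrightarrow> up_laplacian K \<omega> i f F = \<mu> * f F"
    using assms(2) unfolding up_eigenvalue_def by blast
  obtain F where "F \<in> faces K i" "f F \<noteq> 0" "\<And>F'. F' \<in> faces K i \<Longrightarrow> \<bar>f F'\<bar> \<le> \<bar>f F\<bar>"
    using exists_maximal_face[OF assms(1) f(1)] by blast
  with f(2) maximal_row(1)[OF assms(1)] show ?thesis by blast
qed

text \<open>Maximal modulus passes between adjacent \<open>(i+1)\<close>-faces through their common
  \<open>i\<close>-face, hence reaches every \<open>i\<close>-face with a coface. Then
  \<open>incidence_sgn \<omega> F G * f F\<close> depends on \<open>G\<close> alone, and its sign is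
  the potential at \<open>G\<close>.\<close>

lemma top_eigenvalue_imp_potential:
  assumes K: "simplicial_complex K" and conn: "up_path_connected K i"
    and ev: "up_eigenvalue K \<omega> i (real i + 2)"
  shows "\<exists>\<epsilon>. face_potential K i (incidence_sgn \<omega>) \<epsilon>"
proof -
  obtain f where f: "\<exists>F\<in>faces K i. f F \<noteq> 0"
    "\<And>F. F \<in> faces K i \<Longrightarrow> up_laplacian K \<omega> i f F = (real i + 2) * f F"
    using ev unfolding up_eigenvalue_def by blast
  obtain F\<^sub>0 where F\<^sub>0: "F\<^sub>0 \<in> faces K i" "f F\<^sub>0 \<noteq> 0"
    and max: "\<And>F'. F' \<in> faces K i \<Longrightarrow> \<bar>f F'\<bar> \<le> \<bar>f F\<^sub>0\<bar>"
    using exists_maximal_face[OF K f(1)] by blast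
  have step: "incidence_sgn \<omega> F' G * f F' = incidence_sgn \<omega> F G * f F"
    if "F \<in> faces K i" "\<bar>f F\<bar> = \<bar>f F\<^sub>0\<bar>" "G \<in> faces K (i + 1)" "F \<subset> G" "F' \<in> faces K i" "F' \<subset> G"
    for F F' G
    using that F\<^sub>0(2) max f(2)[OF that(1)] by (intro maximal_row(3)[OF K that(1)]) auto
  have spread: "\<bar>f F'\<bar> = \<bar>f F\<^sub>0\<bar>"
    if "F \<in> faces K i" "\<bar>f F\<bar> = \<bar>f F\<^sub>0\<bar>" "G \<in> faces K (i + 1)" "F \<subset> G" "F' \<in> faces K i" "F' \<subset> G"
    for F F' G
    using step[OF that] incidence_sgn_pm1[of \<omega> F G] incidence_sgn_pm1[of \<omega> F' G] that(2) by auto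
  obtain G\<^sub>0 where G\<^sub>0: "G\<^sub>0 \<in> faces K (i + 1)" "F\<^sub>0 \<subset> G\<^sub>0"
    using maximal_row(2)[OF K F\<^sub>0 max f(2)[OF F\<^sub>0(1)] refl] by blast
  have const: "\<bar>f F\<bar> = \<bar>f F\<^sub>0\<bar>" if "G \<in> faces K (i + 1)" "F \<in> faces K i" "F \<subset> G" for F G
  proof -
    have "(G\<^sub>0, G) \<in> (face_adj K i)\<^sup>*"
      using conn G\<^sub>0(1) that(1) by (simp add: up_path_connected_iff_rtrancl)
    then have "\<forall>F\<in>faces K i. F \<subset> G \<longrightarrow> \<bar>f F\<bar> = \<bar>f F\<^sub>0\<bar>"
    proof (induction rule: rtrancl_induct)
      case base
      show ?case using spread[OF F\<^sub>0(1) refl G\<^sub>0] by blast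
    next
      case (step G G')
      let ?F = "G \<inter> G'"
      have "G \<in> faces K (i + 1)" "G' \<in> faces K (i + 1)" "?F \<in> faces K i"
        using step.hyps(2) by (auto simp: face_adj_def)
      moreover from this have "?F \<noteq> G" "?F \<noteq> G'" by (auto simp: faces_def)
      ultimately show ?case using step.IH spread[of ?F G'] by blast
    qed
    with that show ?thesis by blast
  qed
  have "\<exists>m. \<forall>F\<in>faces K i. F \<subset> G \<longrightarrow> incidence_sgn \<omega> F G * f F = m" if "G \<in> faces K (i + 1)" for G
    using step const that by metis
  then obtain m where m: "\<And>F G. G \<in> faces K (i + 1) \<Longrightarrow> F \<in> faces K i \<Longrightarrow> F \<subset> G \<Longrightarrow>
      incidence_sgn \<omega> F G * f F = m G" by metis
  \<comment> \<open>Unlike \<open>sgn\<close>, this sends 0 to 1, because a potential must be a sign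
    everywhere, also on sets that are no faces.\<close>
  define pm where "pm x = (if x < 0 then -1 else 1 :: real)" for x :: real
  define \<epsilon> where "\<epsilon> H = pm (if card H = i + 1 then f H else m H)" for H
  have "face_potential K i (incidence_sgn \<omega>) \<epsilon>"
    unfolding face_potential_def
  proof (intro conjI ballI impI allI)
    fix F G assume FG: "F \<in> faces K i" "G \<in> faces K (i + 1)" "F \<subset> G"
    then have "f F \<noteq> 0" using const[of G F] F\<^sub>0(2) by auto
    moreover have "\<epsilon> F = pm (f F)" "\<epsilon> G = pm (m G)" using FG by (auto simp: \<epsilon>_def faces_def)
    ultimately show "incidence_sgn \<omega> F G = \<epsilon> F * \<epsilon> G"
      using m[OF FG(2,1,3)] incidence_sgn_pm1[of \<omega> F G] by (auto simp: pm_def)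
  qed (auto simp: \<epsilon>_def pm_def)
  then show ?thesis by blast
qed

text \<open>With a potential every summand in the inner sum for \<open>G\<close> equals
  \<open>\<epsilon> G\<close>, so the bounds of the maximum principle are all attained.\<close>

lemma potential_imp_top_eigenvalue:
  assumes K: "simplicial_complex K" and ne: "faces K (i + 1) \<noteq> {}"
    and p: "face_potential K i (incidence_sgn \<omega>) \<epsilon>"
  shows "up_eigenvalue K \<omega> i (real i + 2)"
proof -
  \<comment> \<open>The row of a face without cofaces is 0, so an eigenfunction for
    \<open>i + 2\<close> has to vanish there.\<close>
  define f where "f F = (if \<exists>G\<in>faces K (i + 1). F \<subset> G then \<epsilon> F else 0)" for F
  have pm: "\<epsilon> F = 1 \<or> \<epsilon> F = -1" for F using p by (auto simp: face_potential_def)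
  obtain G where G: "G \<in> faces K (i + 1)" using ne by blast
  then have "card {F \<in> faces K i. F \<subset> G} \<noteq> 0" using card_subfaces[OF K G] by simp
  then obtain F where "F \<in> faces K i" "F \<subset> G" by (metis (no_types, lifting) card.empty Collect_empty_eq)
  moreover from this G have "f F = \<epsilon> F" unfolding f_def by (intro if_P) blast
  ultimately have "\<exists>F\<in>faces K i. f F \<noteq> 0" using pm[of F] by force
  moreover have "up_laplacian K \<omega> i f F = (real i + 2) * f F" if F: "F \<in> faces K i" for F
  proof (cases "{G \<in> faces K (i + 1). F \<subset> G} = {}")
    case True
    then have "f F = 0" unfolding f_def by (intro if_not_P) blast
    then show ?thesis unfolding up_laplacian_conv_boundary[OF K F] True by simp
  next
    case False
    let ?w = "\<lambda>G. face_weight K G / face_weight K F"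
    have "incidence_sgn \<omega> F G * (\<Sum>F'\<in>{F' \<in> faces K i. F' \<subset> G}. incidence_sgn \<omega> F' G * f F') = (real i + 2) * \<epsilon> F"
      if G: "G \<in> faces K (i + 1)" "F \<subset> G" for G
    proof -
      have "(\<Sum>F'\<in>{F' \<in> faces K i. F' \<subset> G}. incidence_sgn \<omega> F' G * f F') =
          (\<Sum>F'\<in>{F' \<in> faces K i. F' \<subset> G}. \<epsilon> G)"
      proof (rule sum.cong[OF refl])
        fix F' assume "F' \<in> {F' \<in> faces K i. F' \<subset> G}"
        with p G have "incidence_sgn \<omega> F' G = \<epsilon> F' * \<epsilon> G" "f F' = \<epsilon> F'"
          by (auto simp: face_potential_def f_def)
        with pm[of F'] show "incidence_sgn \<omega> F' G * f F' = \<epsilon> G" by auto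
      qed
      moreover have "incidence_sgn \<omega> F G = \<epsilon> F * \<epsilon> G" using p F G by (simp add: face_potential_def)
      ultimately show ?thesis using pm[of G] card_subfaces[OF K G(1)] by auto
    qed
    then have "up_laplacian K \<omega> i f F =
        (\<Sum>G\<in>{G \<in> faces K (i + 1). F \<subset> G}. ?w G * ((real i + 2) * \<epsilon> F))"
      unfolding up_laplacian_conv_boundary[OF K F] by (intro sum.cong) auto
    also have "\<dots> = (real i + 2) * \<epsilon> F"
      using sum_coface_weight[OF K F False] by (simp only: flip: sum_distrib_right)
    also have "\<epsilon> F = f F" using False by (auto simp: f_def)
    finally show ?thesis .
  qed
  ultimately show ?thesis unfolding up_eigenvalue_def by blast
qed

text \<open>The spectrum is finite, contains 0 and is bounded by \<open>i + 2\<close>, which is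
  therefore its maximum iff it is an eigenvalue.\<close>

lemma lambda_max_eq_iff_potential:
  assumes "simplicial_complex K" "orientation K \<omega>" "up_path_connected K i" "faces K (i + 1) \<noteq> {}"
  shows "lambda_max K \<omega> i = real i + 2 \<longleftrightarrow> (\<exists>\<epsilon>. face_potential K i (incidence_sgn \<omega>) \<epsilon>)"
proof -
  let ?S = "{\<mu>. up_eigenvalue K \<omega> i \<mu>}"
  obtain G where G: "G \<in> faces K (i + 1)" using assms(4) by blast
  then have "card {F \<in> faces K i. F \<subset> G} \<noteq> 0" using card_subfaces[OF assms(1) G] by simp
  then have "faces K i \<noteq> {}" by (metis (no_types, lifting) card.empty Collect_empty_eq empty_iff)
  then have "?S \<noteq> {}" using zero_up_eigenvalue[OF assms(1,2)] by blast
  with finite_up_eigenvalues[OF assms(1)] have "Max ?S \<in> ?S" by (rule Max_in)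
  moreover have "Max ?S = real i + 2" if "real i + 2 \<in> ?S"
    using finite_up_eigenvalues[OF assms(1)] that up_eigenvalue_le[OF assms(1)] by (intro Max_eqI) auto
  ultimately have "lambda_max K \<omega> i = real i + 2 \<longleftrightarrow> real i + 2 \<in> ?S"
    unfolding lambda_max_def by metis
  with top_eigenvalue_imp_potential[OF assms(1,3)] potential_imp_top_eigenvalue[OF assms(1,4)]
  show ?thesis by auto
qed

section \<open>Duplication\<close>

lemma simplicial_complex_down_closure:
  assumes "simplicial_complex K" "S \<subseteq> K"
  shows "subcomplex {F. \<exists>H\<in>S. F \<subseteq> H} K"
proof -
  have "{F. \<exists>H\<in>S. F \<subseteq> H} \<subseteq> K" using assms face_subset by blast
  moreover have "finite K" using assms(1) by (simp add: simplicial_complex_def)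
  ultimately have "finite {F. \<exists>H\<in>S. F \<subseteq> H}" by (rule finite_subset)
  moreover have "G \<in> {F. \<exists>H\<in>S. F \<subseteq> H}" if "F \<in> {F. \<exists>H\<in>S. F \<subseteq> H}" "G \<subseteq> F" for F G
    using that by blast
  ultimately show ?thesis
    using \<open>{F. \<exists>H\<in>S. F \<subseteq> H} \<subseteq> K\<close> unfolding subcomplex_def simplicial_complex_def by blast
qed

lemma cplx_closure_eq:
  assumes "simplicial_complex K" "S \<subseteq> K"
  shows "cplx_closure K S = {F. \<exists>H\<in>S. F \<subseteq> H}"
proof
  have "S \<subseteq> {F. \<exists>H\<in>S. F \<subseteq> H}" by blast
  with simplicial_complex_down_closure[OF assms] show "cplx_closure K S \<subseteq> {F. \<exists>H\<in>S. F \<subseteq> H}"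
    unfolding cplx_closure_def by (intro Inter_lower) simp
  show "{F. \<exists>H\<in>S. F \<subseteq> H} \<subseteq> cplx_closure K S"
    unfolding cplx_closure_def using face_subset unfolding subcomplex_def by blast
qed

lemma mem_star_iff:
  assumes "subcomplex \<Sigma> K"
  shows "F \<in> cplx_star K \<Sigma> \<longleftrightarrow> F \<in> K \<and> F \<inter> vertex_set \<Sigma> \<noteq> {}"
proof -
  have "{x} \<in> \<Sigma>" if "x \<in> vertex_set \<Sigma>" for x
    using that assms face_subset[of \<Sigma> _ "{x}"] by (auto simp: vertex_set_def subcomplex_def)
  then show ?thesis
    unfolding cplx_star_def vertex_set_def by blast
qed

text \<open>A complex is its own closure, so the removed part is the star of
  \<open>\<Sigma>\<close>, and a face below the star avoids it exactly by having no vertex in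
  \<open>\<Sigma>\<close>.\<close>

lemma mem_link_iff:
  assumes "simplicial_complex K" "subcomplex \<Sigma> K"
  shows "F \<in> cplx_link K \<Sigma> \<longleftrightarrow>
    F \<inter> vertex_set \<Sigma> = {} \<and> (\<exists>H\<in>K. H \<inter> vertex_set \<Sigma> \<noteq> {} \<and> F \<subseteq> H)"
proof -
  have \<Sigma>: "simplicial_complex \<Sigma>" "\<Sigma> \<subseteq> K" using assms(2) by (simp_all add: subcomplex_def)
  have "cplx_closure K \<Sigma> = \<Sigma>"
    using cplx_closure_eq[OF assms(1) \<Sigma>(2)] face_subset[OF \<Sigma>(1)] by blast
  moreover have "cplx_star K \<Sigma> \<subseteq> K" by (auto simp: cplx_star_def)
  ultimately have "F \<in> cplx_link K \<Sigma> \<longleftrightarrow>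
      (\<exists>H\<in>cplx_star K \<Sigma>. F \<subseteq> H) \<and> F \<notin> cplx_star K \<Sigma>"
    by (simp add: cplx_link_def cplx_closure_eq[OF assms(1)])
  also have "\<dots> \<longleftrightarrow> F \<inter> vertex_set \<Sigma> = {} \<and> (\<exists>H\<in>K. H \<inter> vertex_set \<Sigma> \<noteq> {} \<and> F \<subseteq> H)"
    unfolding mem_star_iff[OF assms(2)] Bex_def using face_subset[OF assms(1)] by meson
  finally show ?thesis .
qed

lemma cplx_dim_attained:
  assumes "finite L" "cplx_dim L = int i"
  obtains F where "F \<in> L" "card F = i + 1"
proof -
  have ne: "L \<noteq> {}" using assms(2) by (auto simp: cplx_dim_def)
  then have "Max ((\<lambda>F. int (card F) - 1) ` L) \<in> (\<lambda>F. int (card F) - 1) ` L"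
    using assms(1) by (intro Max_in) auto
  then obtain F where F: "F \<in> L" "cplx_dim L = int (card F) - 1"
    using ne by (auto simp: cplx_dim_def)
  then have "card F = i + 1" using assms(2) by simp
  with F(1) show thesis by (rule that)
qed

locale duplicated_complex =
  fixes K :: "'a set set" and \<Sigma> :: "'a set set" and i :: nat and c :: "'a \<Rightarrow> 'a"
  assumes cplx: "simplicial_complex K"
    and motif: "motif K i \<Sigma>"
    and copy: "copy_map K \<Sigma> c"
begin

abbreviation V where "V \<equiv> vertex_set \<Sigma>"
abbreviation K' where "K' \<equiv> duplication K \<Sigma> c"

lemma inj_c: "inj_on c V" and c_notin: "x \<in> V \<Longrightarrow> c x \<notin> vertex_set K"
  using copy by (auto simp: copy_map_def)

lemma sub: "subcomplex \<Sigma> K"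
  using motif by (simp add: motif_def)

lemma face_vertices: "F \<in> K \<Longrightarrow> F \<subseteq> vertex_set K"
  by (auto simp: vertex_set_def)

lemma link_vertices:
  assumes "A \<inter> V \<noteq> {}" "A \<in> K"
  shows "A - V \<subseteq> vertex_set (cplx_link K \<Sigma>)"
proof -
  have "A - V \<in> cplx_link K \<Sigma>"
    unfolding mem_link_iff[OF cplx sub] using assms by blast
  then show ?thesis by (auto simp: vertex_set_def)
qed

lemma link_vertices_disjoint: "vertex_set (cplx_link K \<Sigma>) \<inter> V = {}"
  using mem_link_iff[OF cplx sub] unfolding vertex_set_def[of "cplx_link K \<Sigma>"] by blast

section \<open>Lifting faces to the copy\<close>

text \<open>The lifts of faces meeting \<open>\<Sigma>\<close> are the new faces; faces missing
  \<open>\<Sigma>\<close> are their own lifts, so whole walks lift without case distinction.\<close>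

definition lift :: "'a set \<Rightarrow> 'a set" where
  "lift F = c ` (F \<inter> V) \<union> (F - V)"

lemma lift_eq_image: "lift F = (\<lambda>x. if x \<in> V then c x else x) ` F"
  by (auto simp: lift_def)

text \<open>The sets \<open>A\<close> and \<open>B\<close> of the definition are the parts of
  \<open>F = A \<union> B\<close> inside and outside \<open>V\<close>, because link vertices avoid
  \<open>V\<close>; conversely, \<open>F - V\<close> consists of link vertices once \<open>F\<close>
  meets \<open>V\<close>.\<close>

lemma mem_duplication_iff:
  "H \<in> K' \<longleftrightarrow> H \<in> K \<or> (\<exists>F\<in>K. F \<inter> V \<noteq> {} \<and> H = lift F)"
proof
  assume "H \<in> K'"
  then consider "H \<in> K" | A B where "H = c ` A \<union> B" "A \<noteq> {}" "A \<subseteq> V"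
    "B \<subseteq> vertex_set (cplx_link K \<Sigma>)" "A \<union> B \<in> K"
    unfolding duplication_def by blast
  then show "H \<in> K \<or> (\<exists>F\<in>K. F \<inter> V \<noteq> {} \<and> H = lift F)"
  proof cases
    case 2
    then have "(A \<union> B) \<inter> V = A" "A \<union> B - V = B" using link_vertices_disjoint by blast+
    with 2 have "H = lift (A \<union> B)" "(A \<union> B) \<inter> V \<noteq> {}" by (simp_all add: lift_def)
    with 2(5) show ?thesis by (intro disjI2 bexI[of _ "A \<union> B"] conjI)
  qed simp
next
  assume "H \<in> K \<or> (\<exists>F\<in>K. F \<inter> V \<noteq> {} \<and> H = lift F)"
  then show "H \<in> K'"
  proof
    assume "\<exists>F\<in>K. F \<inter> V \<noteq> {} \<and> H = lift F"
    then obtain F where F: "F \<in> K" "F \<inter> V \<noteq> {}" "H = lift F" by blast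
    have "F \<inter> V \<union> (F - V) \<in> K" using F(1) by (simp add: Int_Diff_Un)
    then have "lift F \<in> {c ` A \<union> B | A B. A \<noteq> {} \<and> A \<subseteq> V \<and>
        B \<subseteq> vertex_set (cplx_link K \<Sigma>) \<and> A \<union> B \<in> K}"
      unfolding lift_def using F(2) link_vertices[OF F(2,1)]
      by (intro CollectI exI[of _ "F \<inter> V"] exI[of _ "F - V"] conjI) simp_all
    then show ?thesis unfolding duplication_def F(3) by (rule UnI2)
  qed (simp add: duplication_def)
qed

lemma lift_id: "F \<inter> V = {} \<Longrightarrow> lift F = F"
  by (auto simp: lift_def)

lemma lift_in_duplication: "F \<in> K \<Longrightarrow> lift F \<in> K'"
  unfolding mem_duplication_iff using lift_id by metis

section \<open>Folding the duplicated complex onto \<open>K\<close>\<close>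

definition retr :: "'a \<Rightarrow> 'a" where
  "retr x = (if x \<in> c ` V then inv_into V c x else x)"

lemma retr_c: "x \<in> V \<Longrightarrow> retr (c x) = x"
  by (simp add: retr_def inv_into_f_f[OF inj_c])

lemma retr_id: "x \<in> vertex_set K \<Longrightarrow> retr x = x"
  using c_notin by (auto simp: retr_def)

lemma retr_image_face: "F \<in> K \<Longrightarrow> retr ` F = F"
  using retr_id face_vertices by (force simp: image_iff)

lemma retr_image_lift:
  assumes "F \<in> K"
  shows "retr ` lift F = F"
proof -
  have "retr ` c ` (F \<inter> V) = F \<inter> V"
    unfolding image_image using retr_c by (simp cong: image_cong_simp)
  moreover have "retr ` (F - V) = F - V"
    by (rule retr_image_face[OF face_subset[OF cplx assms]]) blast
  ultimately show ?thesis by (auto simp: lift_def image_Un)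
qed

text \<open>A face never contains a vertex of \<open>\<Sigma>\<close> together with its duplicate:
  faces of \<open>K\<close> have no duplicates, and lifts have no vertices of
  \<open>\<Sigma>\<close>. Hence folding preserves dimension.\<close>

lemma inj_on_retr:
  assumes "H \<in> K'"
  shows "inj_on retr H"
  using assms unfolding mem_duplication_iff
proof
  assume "H \<in> K"
  then have "inj_on retr H \<longleftrightarrow> inj_on id H"
    using retr_id face_vertices by (intro inj_on_cong) auto
  then show ?thesis by simp
next
  assume "\<exists>F\<in>K. F \<inter> V \<noteq> {} \<and> H = lift F"
  then obtain F where F: "F \<in> K" "H = lift F" by blast
  have r: "retr (if x \<in> V then c x else x) = x" if "x \<in> F" for x
    using that F(1) retr_c retr_id face_vertices by auto
  show ?thesis
    unfolding F(2) lift_eq_image by (rule inj_on_imageI) (use r in \<open>simp add: inj_on_def\<close>)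
qed

lemma retr_image: "H \<in> K' \<Longrightarrow> retr ` H \<in> K"
  unfolding mem_duplication_iff using retr_image_face retr_image_lift by auto

lemma card_lift:
  assumes "F \<in> K"
  shows "card (lift F) = card F"
  using card_image[OF inj_on_retr[OF lift_in_duplication[OF assms]]] retr_image_lift[OF assms] by simp

lemma simplicial_complex_duplication: "simplicial_complex K'"
  unfolding simplicial_complex_def
proof (intro conjI ballI allI impI)
  have "K' \<subseteq> K \<union> lift ` K" using mem_duplication_iff by blast
  moreover have "finite (K \<union> lift ` K)" using cplx by (simp add: simplicial_complex_def)
  ultimately show "finite K'" by (rule finite_subset)
next
  fix H G assume "H \<in> K'" "G \<subseteq> H"
  then consider "H \<in> K" | F where "F \<in> K" "H = lift F" unfolding mem_duplication_iff by blast
  then show "G \<in> K'"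
  proof cases
    case 1
    from face_subset[OF cplx this \<open>G \<subseteq> H\<close>] show ?thesis unfolding mem_duplication_iff by (rule disjI1)
  next
    case 2
    with \<open>G \<subseteq> H\<close> have "G \<subseteq> (\<lambda>x. if x \<in> V then c x else x) ` F" by (simp add: lift_eq_image)
    \<comment> \<open>A subset of a lift is the lift of a subset, which falls back into
      \<open>K\<close> if it misses \<open>\<Sigma>\<close>.\<close>
    then obtain F' where "F' \<subseteq> F" "G = lift F'" unfolding lift_eq_image by (rule subset_imageE)
    with 2 show ?thesis using face_subset[OF cplx, of F F'] lift_in_duplication by simp
  qed
qed

lemma faces_subset_duplication: "F \<in> faces K n \<Longrightarrow> F \<in> faces K' n"
  by (simp add: faces_def mem_duplication_iff)

lemma retr_faces:
  assumes "H \<in> faces K' n"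
  shows "retr ` H \<in> faces K n"
  using assms retr_image[of H] card_image[OF inj_on_retr, of H] by (simp add: faces_def)

lemma lift_faces: "F \<in> faces K n \<Longrightarrow> lift F \<in> faces K' n"
  by (simp add: faces_def lift_in_duplication card_lift)

section \<open>Connectedness of the duplicated complex\<close>

text \<open>The face \<open>insert v L\<close> is adjacent to its own copy, which joins the copied part of the
  complex to the original one.\<close>

lemma exists_bridge:
  obtains L v where "L \<inter> V = {}" "v \<in> V" "L \<in> faces K i" "insert v L \<in> faces K (i + 1)"
proof -
  have "cplx_link K \<Sigma> \<subseteq> K"
  proof
    fix F assume "F \<in> cplx_link K \<Sigma>"
    then obtain H where "H \<in> K" "F \<subseteq> H" unfolding mem_link_iff[OF cplx sub] by blast
    then show "F \<in> K" by (rule face_subset[OF cplx])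
  qed
  moreover have "finite K" using cplx by (simp add: simplicial_complex_def)
  ultimately have "finite (cplx_link K \<Sigma>)" by (rule finite_subset)
  moreover have "cplx_dim (cplx_link K \<Sigma>) = int i" using motif by (simp add: motif_def)
  \<comment> \<open>The dimension of the link yields the \<open>i\<close>-face \<open>L\<close>;
    membership in the link then yields a simplex of \<open>K\<close> through \<open>L\<close> with a
    vertex \<open>v\<close> of \<open>\<Sigma>\<close>.\<close>
  ultimately obtain L where L: "L \<in> cplx_link K \<Sigma>" "card L = i + 1" by (rule cplx_dim_attained)
  then obtain H v where H: "L \<inter> V = {}" "H \<in> K" "v \<in> H" "v \<in> V" "L \<subseteq> H"
    unfolding mem_link_iff[OF cplx sub] by blast
  then have "L \<in> K" "insert v L \<in> K" "v \<notin> L" using face_subset[OF cplx, of H] by blast+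
  moreover from this have "card (insert v L) = i + 2" using L(2) finite_face[OF cplx] by simp
  ultimately show thesis using that[of L v] H L(2) by (simp add: faces_def)
qed

text \<open>Duplicates are fresh and \<open>c\<close> is injective on \<open>V\<close>, so lifting
  neither creates nor destroys coincidences. Adjacent faces thus have adjacent lifts.\<close>

lemma lift_Int:
  assumes "F \<in> K" "G \<in> K"
  shows "lift F \<inter> lift G = lift (F \<inter> G)"
proof -
  have "c ` (F \<inter> V) \<inter> c ` (G \<inter> V) = c ` (F \<inter> V \<inter> (G \<inter> V))"
    using inj_on_image_Int[OF inj_c, of "F \<inter> V" "G \<inter> V"] by simp
  moreover have "c ` (F \<inter> V) \<inter> (G - V) = {}" "c ` (G \<inter> V) \<inter> (F - V) = {}"
    using assms face_vertices c_notin by blast+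
  ultimately show ?thesis by (auto simp: lift_def)
qed

text \<open>A new face is the lift of a face of \<open>K\<close>, which is joined in
  \<open>K\<close> to the bridge simplex \<open>?B\<close>. That walk lifts, ends in the copy of
  \<open>?B\<close>, and crosses over to \<open>?B\<close> through \<open>L\<close>.\<close>

lemma up_path_connected_duplication:
  assumes "up_path_connected K i"
  shows "up_path_connected K' i"
proof -
  let ?R = "face_adj K i" and ?R' = "face_adj K' i"
  have conn: "(F, G) \<in> ?R\<^sup>*" if "F \<in> faces K (i + 1)" "G \<in> faces K (i + 1)" for F G
    using assms that by (simp add: up_path_connected_iff_rtrancl)
  have "?R \<subseteq> ?R'" using faces_subset_duplication by (auto simp: face_adj_def)
  then have mono: "?R\<^sup>* \<subseteq> ?R'\<^sup>*" by (rule rtrancl_mono)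
  obtain L v where L: "L \<inter> V = {}" "v \<in> V" "L \<in> faces K i" and Lv: "insert v L \<in> faces K (i + 1)"
    by (rule exists_bridge)
  let ?B = "insert v L"
  have lifted: "\<exists>G\<in>faces K (i + 1). (lift F, G) \<in> ?R'\<^sup>*" if "(F, ?B) \<in> ?R\<^sup>*" for F
    using that
  proof (induction rule: converse_rtrancl_induct)
    case base
    have "lift ?B = insert (c v) L" using L by (auto simp: lift_def)
    moreover have "c v \<notin> ?B" using c_notin[OF L(2)] face_vertices[of ?B] Lv by (auto simp: faces_def)
    ultimately have "lift ?B \<inter> ?B = L" by auto
    then have "(lift ?B, ?B) \<in> ?R'"
      using L Lv faces_subset_duplication lift_faces by (simp add: face_adj_def)
    with Lv show ?case by blast
  next
    case (step F G)
    then have FG: "F \<in> faces K (i + 1)" "G \<in> faces K (i + 1)" "F \<inter> G \<in> faces K i"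
      by (auto simp: face_adj_def)
    have "lift F \<inter> lift G \<in> faces K' i"
      using FG lift_faces[OF FG(3)] by (simp add: lift_Int faces_def)
    then have "(lift F, lift G) \<in> ?R'"
      using FG lift_faces by (simp add: face_adj_def)
    with step.IH show ?case by (meson converse_rtrancl_into_rtrancl)
  qed
  have reach: "\<exists>G\<in>faces K (i + 1). (H, G) \<in> ?R'\<^sup>*" if H: "H \<in> faces K' (i + 1)" for H
  proof -
    consider "H \<in> K" | F where "F \<in> K" "H = lift F"
      using H unfolding faces_def mem_duplication_iff by blast
    then show ?thesis
    proof cases
      case 1
      with H have "H \<in> faces K (i + 1)" by (simp add: faces_def)
      then show ?thesis by blast
    next
      case 2
      with H have "F \<in> faces K (i + 1)" by (simp add: faces_def card_lift)
      with 2 lifted[OF conn[OF _ Lv]] show ?thesis by simp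
    qed
  qed
  have "(H\<^sub>1, H\<^sub>2) \<in> ?R'\<^sup>*" if H: "H\<^sub>1 \<in> faces K' (i + 1)" "H\<^sub>2 \<in> faces K' (i + 1)" for H\<^sub>1 H\<^sub>2
  proof -
    obtain G\<^sub>1 where G1: "G\<^sub>1 \<in> faces K (i + 1)" "(H\<^sub>1, G\<^sub>1) \<in> ?R'\<^sup>*" using reach[OF H(1)] by blast
    obtain G\<^sub>2 where G2: "G\<^sub>2 \<in> faces K (i + 1)" "(H\<^sub>2, G\<^sub>2) \<in> ?R'\<^sup>*" using reach[OF H(2)] by blast
    have "(G\<^sub>2, H\<^sub>2) \<in> ?R'\<^sup>*" using G2(2) sym_rtrancl[OF sym_face_adj] by (rule symD[rotated])
    moreover have "(G\<^sub>1, G\<^sub>2) \<in> ?R'\<^sup>*" using conn[OF G1(1) G2(1)] mono by blast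
    ultimately show ?thesis using G1(2) by (meson rtrancl_trans)
  qed
  then show ?thesis unfolding up_path_connected_iff_rtrancl by blast
qed

section \<open>Transfer of potentials between \<open>K\<close> and its duplication\<close>

text \<open>Ordering each duplicate like its original makes folding preserve order signs, since it
  is injective on faces. Potentials then restrict to \<open>K\<close> and pull back from it.\<close>

lemma potential_duplication_iff:
  "(\<exists>\<epsilon>. face_potential K' i (order_sgn (\<rho> \<circ> retr)) \<epsilon>) \<longleftrightarrow> (\<exists>\<epsilon>. face_potential K i (order_sgn \<rho>) \<epsilon>)"
proof -
  have sgn: "order_sgn (\<rho> \<circ> retr) F G = order_sgn \<rho> (retr ` F) (retr ` G)" if "G \<in> K'" "F \<subseteq> G" for F G
  proof -
    have inj: "inj_on retr G" using that(1) by (rule inj_on_retr)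
    have "retr ` G - retr ` F = retr ` (G - F)"
      using inj that(2) by (simp add: inj_on_image_set_diff)
    moreover have "inj_on retr F" "inj_on retr (G - F)" using inj that(2) by (auto intro: inj_on_subset)
    ultimately show ?thesis by (simp add: order_sgn_def prod.reindex)
  qed
  have "face_potential K i (order_sgn \<rho>) \<epsilon>"
    if p: "face_potential K' i (order_sgn (\<rho> \<circ> retr)) \<epsilon>" for \<epsilon>
    unfolding face_potential_def
  proof (intro conjI ballI impI)
    fix F G assume FG: "F \<in> faces K i" "G \<in> faces K (i + 1)" "F \<subset> G"
    then have "order_sgn (\<rho> \<circ> retr) F G = \<epsilon> F * \<epsilon> G"
      using p faces_subset_duplication by (simp add: face_potential_def)
    moreover have "order_sgn (\<rho> \<circ> retr) F G = order_sgn \<rho> F G"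
      using sgn[of G F] FG retr_image_face by (simp add: faces_def mem_duplication_iff)
    ultimately show "order_sgn \<rho> F G = \<epsilon> F * \<epsilon> G" by simp
  qed (use p in \<open>simp add: face_potential_def\<close>)
  moreover have "face_potential K' i (order_sgn (\<rho> \<circ> retr)) (\<lambda>F. \<epsilon> (retr ` F))"
    if p: "face_potential K i (order_sgn \<rho>) \<epsilon>" for \<epsilon>
    unfolding face_potential_def
  proof (intro conjI ballI impI)
    fix F G assume FG: "F \<in> faces K' i" "G \<in> faces K' (i + 1)" "F \<subset> G"
    note r = retr_faces[OF FG(1)] retr_faces[OF FG(2)]
    then have "retr ` F \<noteq> retr ` G" by (auto simp: faces_def)
    with FG(3) have "retr ` F \<subset> retr ` G" by blast
    with p r have "order_sgn \<rho> (retr ` F) (retr ` G) = \<epsilon> (retr ` F) * \<epsilon> (retr ` G)"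
      by (simp add: face_potential_def)
    with sgn[of G F] FG show "order_sgn (\<rho> \<circ> retr) F G = \<epsilon> (retr ` F) * \<epsilon> (retr ` G)"
      by (simp add: faces_def psubset_imp_subset)
  qed (use p in \<open>simp add: face_potential_def\<close>)
  ultimately show ?thesis by blast
qed

text \<open>\<open>\<omega>\<close> and \<open>\<omega>'\<close> are unrelated; the order signs,
  which depend on no orientation, mediate between them.\<close>

lemma lambda_max_duplication_iff:
  assumes "up_path_connected K i" "orientation K \<omega>" "orientation K' \<omega>'"
  shows "lambda_max K' \<omega>' i = real i + 2 \<longleftrightarrow> incidence_graph_balanced K \<omega> i"
proof -
  obtain \<rho> :: "'a \<Rightarrow> nat" where \<rho>: "inj_on \<rho> (vertex_set K)"
    using finite_imp_inj_to_nat_seg[OF finite_vertex_set[OF cplx]] by blast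
  have inj: "inj_on \<rho> F" if "F \<in> K" for F
    using \<rho> face_vertices[OF that] by (rule inj_on_subset)
  \<comment> \<open>A vertex and its duplicate share a value, but no face contains both, and signs
    are only compared within single faces.\<close>
  have inj': "inj_on (\<rho> \<circ> retr) H" if "H \<in> K'" for H
    using inj_on_retr[OF that] inj[OF retr_image[OF that]] by (rule comp_inj_on)
  obtain L v where "insert v L \<in> faces K (i + 1)" by (rule exists_bridge)
  then have "faces K' (i + 1) \<noteq> {}" using faces_subset_duplication by blast
  then have "lambda_max K' \<omega>' i = real i + 2 \<longleftrightarrow> (\<exists>\<epsilon>. face_potential K' i (incidence_sgn \<omega>') \<epsilon>)"
    using lambda_max_eq_iff_potential[OF simplicial_complex_duplication assms(3)]
      up_path_connected_duplication[OF assms(1)] by blast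
  also have "\<dots> \<longleftrightarrow> (\<exists>\<epsilon>. face_potential K' i (order_sgn (\<rho> \<circ> retr)) \<epsilon>)"
    using potential_incidence_sgn_iff_order_sgn[OF simplicial_complex_duplication assms(3) inj'] .
  also have "\<dots> \<longleftrightarrow> (\<exists>\<epsilon>. face_potential K i (order_sgn \<rho>) \<epsilon>)"
    by (rule potential_duplication_iff)
  also have "\<dots> \<longleftrightarrow> (\<exists>\<epsilon>. face_potential K i (incidence_sgn \<omega>) \<epsilon>)"
    using potential_incidence_sgn_iff_order_sgn[OF cplx assms(2) inj] by simp
  also have "\<dots> \<longleftrightarrow> incidence_graph_balanced K \<omega> i"
    by (rule incidence_graph_balanced_iff_potential[OF cplx, symmetric])
  finally show ?thesis .
qed

end

theorem theorem4p14:
  fixes K \<Sigma> :: "'a set set" and i :: nat and c :: "'a \<Rightarrow> 'a"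
    and \<omega> \<omega>' :: "'a set \<Rightarrow> 'a list"
  assumes "simplicial_complex K"
    and "up_path_connected K i"
    and "motif K i \<Sigma>"
    and "copy_map K \<Sigma> c"
    and "orientation K \<omega>"
    and "orientation (duplication K \<Sigma> c) \<omega>'"
  shows "up_path_connected (duplication K \<Sigma> c) i \<and>
         (lambda_max (duplication K \<Sigma> c) \<omega>' i = real i + 2 \<longleftrightarrow> incidence_graph_balanced K \<omega> i)"
proof -
  interpret duplicated_complex K \<Sigma> i c by standard (use assms in auto)
  show ?thesis using up_path_connected_duplication lambda_max_duplication_iff assms by blast
qed

end
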